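(* Let $g_1,\ldots,g_k\in \mathrm{GL}_2^+(\mathbb{Q})$. If the functions $j(g_1z),\ldots,j(g_kz)$ on $\mathbb{H}$ are pairwise distinct, then they are multiplicatively independent modulo constants.
   Context: $\mathbb{H}=\{z\in\mathbb{C}:\operatorname{Im}(z)>0\}$, $j:\mathbb{H}\to\mathbb{C}$ is the elliptic modular function, and $\mathrm{GL}_2^+(\mathbb{Q})$ (rational $2\times 2$ matrices of positive determinant) acts on $\mathbb{H}$ by fractional linear transformations, $z\mapsto gz$. Functions $f_1,\ldots,f_k:\mathbb{H}\to\mathbb{C}$ are called multiplicatively independent modulo constants if there is no relation $\prod_{i=1}^k f_i^{n_i}=c$ where $n_1,\ldots,n_k$ are integers, not all zero, and $c\in\mathbb{C}$. *)

theory Defs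
  imports "HOL-Complex_Analysis.Complex_Analysis"
begin

definition upper_half_plane :: "complex set" where
  "upper_half_plane = {z. Im z > 0}"

text \<open>
  \<open>eisenstein_G n z\<close> is the Eisenstein series of the lattice \<open>\<int> z + \<int>\<close>. For \<open>n \<ge> 3\<close> and \<open>z\<close>
  in the upper half plane, the only case used, it converges absolutely, so the unordered sum is the
  usual value.
\<close>

definition eisenstein_G :: "nat \<Rightarrow> complex \<Rightarrow> complex" where
  "eisenstein_G n z =
     (\<Sum>\<^sub>\<infinity>(a, b) \<in> (UNIV :: (int \<times> int) set) - {(0, 0)}. 1 / (of_int a * z + of_int b) ^ n)"

definition modular_g2 :: "complex \<Rightarrow> complex" where
  "modular_g2 z = 60 * eisenstein_G 4 z"

definition modular_g3 :: "complex \<Rightarrow> complex" where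
  "modular_g3 z = 140 * eisenstein_G 6 z"

text \<open>
  The elliptic modular function, with the normalisation \<open>j \<i> = 1728\<close>, that is,
  \<open>j z = 1 / q + 744 + 196884 * q + \<dots>\<close> for \<open>q = exp (2 * pi * \<i> * z)\<close>.
\<close>

definition modular_j :: "complex \<Rightarrow> complex" where
  "modular_j z = 1728 * modular_g2 z ^ 3 / (modular_g2 z ^ 3 - 27 * modular_g3 z ^ 2)"

definition GL2_pos_rat :: "(rat ^ 2 ^ 2) set" where
  "GL2_pos_rat = {A. det A > 0}"

definition moebius_act :: "rat ^ 2 ^ 2 \<Rightarrow> complex \<Rightarrow> complex" where
  "moebius_act A z =
     (of_rat (A $ 1 $ 1) * z + of_rat (A $ 1 $ 2)) / (of_rat (A $ 2 $ 1) * z + of_rat (A $ 2 $ 2))"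

text \<open>
  The exponents may be negative and the functions may have zeros, so a relation
  \<open>f\<^sub>1 powi n\<^sub>1 * \<dots> * f\<^sub>k powi n\<^sub>k = c\<close> is required at exactly those points of the upper
  half plane where no zero is raised to a negative power. (At the excluded points \<open>powi\<close> would take
  the arbitrary value \<open>0\<close>.) For holomorphic functions, none of them identically zero, this is
  equality of meromorphic functions. If every point is excluded, the product of the \<open>f\<^sub>i\<close> with
  negative exponent vanishes identically, so the functions are dependent anyway.
\<close>

definition mult_indep_mod_constants :: "nat \<Rightarrow> (nat \<Rightarrow> complex \<Rightarrow> complex) \<Rightarrow> bool" where
  "mult_indep_mod_constants k f \<longleftrightarrow>
     \<not> (\<exists>(n :: nat \<Rightarrow> int) (c :: complex).
           (\<exists>i\<in>{1..k}. n i \<noteq> 0) \<and>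
           (\<forall>z\<in>upper_half_plane.
              (\<forall>i\<in>{1..k}. n i < 0 \<longrightarrow> f i z \<noteq> 0) \<longrightarrow> (\<Prod>i\<in>{1..k}. f i z powi n i) = c))"

end

theory Submission
  imports Defs
begin

text \<open>
  By invariance under \<open>SL\<^sub>2(\<int>)\<close>, each \<open>j (g\<^sub>i z)\<close> equals \<open>j (\<alpha>\<^sub>i z + \<beta>\<^sub>i)\<close> with \<open>\<alpha>\<^sub>i > 0\<close> and \<open>\<beta>\<^sub>i\<close> real.
  In the closed half plane \<open>Im z \<ge> \<surd>3 / 2\<close> the only zeros of \<open>j\<close> are the integer translates of
  \<open>\<rho> = exp (2 \<pi> \<i> / 3)\<close>. Among the functions with nonzero exponent take one with \<open>\<alpha>\<^sub>m\<close> minimal; its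
  highest zeros are the points \<open>z\<close> with \<open>\<alpha>\<^sub>m z + \<beta>\<^sub>m \<in> \<rho> + \<int>\<close>. At such a point another function
  can vanish only if \<open>\<alpha>\<^sub>i = \<alpha>\<^sub>m\<close> and \<open>\<beta>\<^sub>i - \<beta>\<^sub>m \<in> \<int>\<close>, and then the two functions coincide. So exactly
  one factor of the product vanishes there, and approaching the point from above contradicts the relation.

  The location of the zeros comes from the \<open>q\<close>-expansions of \<open>E\<^sub>4\<close> and \<open>E\<^sub>6\<close>: for \<open>Im z \<ge> \<surd>3 / 2\<close> one has
  \<open>|q| \<le> 1 / 210\<close>, where \<open>E\<^sub>4 - 1\<close> is an injective function of \<open>q\<close> (a small perturbation of \<open>240 q\<close>)
  and \<open>E\<^sub>4\<^sup>3 - E\<^sub>6\<^sup>2\<close> is too close to \<open>1728 q\<close> to vanish.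
\<close>

subsection \<open>The Lipschitz summation formula\<close>

lemma sin_pi_mult_nonzero:
  fixes z :: complex
  assumes "z \<notin> \<int>"
  shows "sin (of_real pi * z) \<noteq> 0"
proof
  assume "sin (of_real pi * z) = 0"
  then obtain n :: int where "of_real pi * z = of_real (of_int n * pi)"
    unfolding sin_eq_0 by auto
  then have "z = of_int n" by simp
  with assms show False by simp
qed

text \<open>Off the integers \<open>Gamma w * Gamma (1 - w) * sin (pi * w)\<close> is constant, so
  its derivative vanishes; dividing by the Gamma factors and the sine leaves the claim.\<close>

lemma Digamma_reflection_complex:
  fixes z :: complex
  assumes "z \<notin> \<int>"
  shows "Digamma (1 - z) - Digamma z = of_real pi * cot (of_real pi * z)"
proof -
  have z1: "1 - z \<notin> \<int>"
    using assms Ints_diff[OF Ints_1, of "1 - z"] by auto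
  have nz: "z \<notin> \<int>\<^sub>\<le>\<^sub>0" "1 - z \<notin> \<int>\<^sub>\<le>\<^sub>0"
    using assms z1 by (meson nonpos_Ints_Int)+
  have s: "sin (of_real pi * z) \<noteq> 0"
    using assms by (rule sin_pi_mult_nonzero)
  let ?D = "Gamma z * Gamma (1 - z) *
      ((Digamma z - Digamma (1 - z)) * sin (of_real pi * z) + of_real pi * cos (of_real pi * z))"
  have "((\<lambda>w. Gamma w * Gamma (1 - w) * sin (of_real pi * w)) has_field_derivative ?D) (at z)"
    using nz by (auto intro!: derivative_eq_intros simp: algebra_simps)
  moreover have "((\<lambda>w. Gamma w * Gamma (1 - w) * sin (of_real pi * w)) has_field_derivative 0) (at z)"
  proof (rule has_field_derivative_transform_within_open[where S = "- \<int>"])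
    show "((\<lambda>_. of_real pi :: complex) has_field_derivative 0) (at z)" by simp
    show "open (- \<int> :: complex set)" by (simp add: closed_Ints open_Compl)
    show "z \<in> - \<int>" using assms by simp
    fix w :: complex assume "w \<in> - \<int>"
    then have "sin (of_real pi * w) \<noteq> 0"
      by (simp add: sin_pi_mult_nonzero)
    then show "of_real pi = Gamma w * Gamma (1 - w) * sin (of_real pi * w)"
      by (simp add: Gamma_reflection_complex)
  qed
  ultimately have "?D = 0" by (rule DERIV_unique)
  moreover have "Gamma z * Gamma (1 - z) \<noteq> 0"
    using nz by (simp add: Gamma_eq_zero_iff)
  ultimately have "(Digamma z - Digamma (1 - z)) * sin (of_real pi * z) + of_real pi * cos (of_real pi * z) = 0"
    by simp
  then show ?thesis using s by (simp add: cot_def field_simps)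
qed

text \<open>The reflection formula holds on an open set and may be differentiated there; the inner
  function \<open>1 - z\<close> contributes the sign.\<close>

lemma Polygamma_reflection_step:
  fixes H :: "complex \<Rightarrow> complex"
  assumes "\<And>z. z \<notin> \<int> \<Longrightarrow> (-1) ^ n * Polygamma n (1 - z) - Polygamma n z = H z"
    and "(H has_field_derivative D) (at z)" and "z \<notin> \<int>"
  shows "(-1) ^ Suc n * Polygamma (Suc n) (1 - z) - Polygamma (Suc n) z = D"
proof (rule DERIV_unique)
  have z1: "1 - z \<notin> \<int>"
    using assms(3) Ints_diff[OF Ints_1, of "1 - z"] by auto
  have nz: "z \<notin> \<int>\<^sub>\<le>\<^sub>0" "1 - z \<notin> \<int>\<^sub>\<le>\<^sub>0"
    using assms(3) z1 by (meson nonpos_Ints_Int)+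
  show "((\<lambda>z. (-1) ^ n * Polygamma n (1 - z) - Polygamma n z) has_field_derivative
          (-1) ^ Suc n * Polygamma (Suc n) (1 - z) - Polygamma (Suc n) z) (at z)"
    using nz by (auto intro!: derivative_eq_intros)
  show "((\<lambda>z. (-1) ^ n * Polygamma n (1 - z) - Polygamma n z) has_field_derivative D) (at z)"
  proof (rule has_field_derivative_transform_within_open[OF assms(2)])
    show "open (- \<int> :: complex set)" by (simp add: closed_Ints open_Compl)
    show "z \<in> - \<int>" using assms by simp
  qed (use assms(1) in auto)
qed

text \<open>The closed forms of \<open>\<Sum>n\<^sup>3 q\<^sup>n\<close> and \<open>\<Sum>n\<^sup>5 q\<^sup>n\<close>.\<close>

definition geom_power3 :: "complex \<Rightarrow> complex" where
  "geom_power3 q = q * (1 + 4 * q + q ^ 2) / (1 - q) ^ 4"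

definition geom_power5 :: "complex \<Rightarrow> complex" where
  "geom_power5 q = q * (1 + 26 * q + 66 * q ^ 2 + 26 * q ^ 3 + q ^ 4) / (1 - q) ^ 6"

text \<open>This is the parameter \<open>q\<close> of modular forms, the square of the classical
  nome \<open>exp (pi * i * z)\<close>.\<close>

definition nome :: "complex \<Rightarrow> complex" where
  "nome z = exp (2 * of_real pi * \<i> * z)"

lemma nome_eq_iff: "nome z = nome w \<longleftrightarrow> z - w \<in> \<int>"
proof
  assume "nome z = nome w"
  then obtain n :: int where "2 * of_real pi * \<i> * z = 2 * of_real pi * \<i> * w + of_real (of_int (2 * n) * pi) * \<i>"
    by (auto simp: nome_def exp_eq)
  then have "(2 * of_real pi * \<i>) * z = (2 * of_real pi * \<i>) * (w + of_int n)" by (simp add: algebra_simps)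
  then have "z = w + of_int n" by simp
  then show "z - w \<in> \<int>" by (simp add: Ints_def)
next
  assume "z - w \<in> \<int>"
  then obtain n :: int where "z = w + of_int n" by (metis Ints_cases add.commute diff_add_cancel)
  then show "nome z = nome w" by (auto simp: nome_def exp_eq algebra_simps intro!: exI[of _ n])
qed

lemma nome_neq_1: "z \<notin> \<int> \<Longrightarrow> nome z \<noteq> 1"
  using nome_eq_iff[of z 0] by (simp add: nome_def)

text \<open>The factor \<open>- (2 * pi * i)\<close> is split off to match the case
  \<open>n = 0\<close> of the shape in \<open>Polygamma_reflection_chain\<close>.\<close>

lemma pi_cot_eq:
  assumes "z \<notin> \<int>"
  shows "of_real pi * cot (of_real pi * z) = - (2 * of_real pi * \<i>) * ((1 + nome z) / (2 * (1 - nome z)))"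
proof -
  define e where "e = exp (\<i> * (of_real pi * z))"
  have q: "nome z = e ^ 2" unfolding e_def nome_def by (simp add: exp_double [symmetric] mult_ac)
  have e0: "e \<noteq> 0" by (simp add: e_def)
  have em: "exp (- (\<i> * (of_real pi * z))) = 1 / e" by (simp add: e_def exp_minus inverse_eq_divide)
  have q1: "e ^ 2 \<noteq> 1" using nome_neq_1[OF assms] q by simp
  have "cot (of_real pi * z) = \<i> * ((e + 1 / e) / (e - 1 / e))"
    unfolding cot_def sin_exp_eq cos_exp_eq minus_mult_left [symmetric] em e_def [symmetric]
    using e0 by (simp add: divide_simps)
  also have "(e + 1 / e) / (e - 1 / e) = (e ^ 2 + 1) / (e ^ 2 - 1)"
    using e0 q1 by (simp add: divide_simps power2_eq_square)
  finally show ?thesis using q1 by (simp add: q divide_simps) (simp add: algebra_simps)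
qed

lemma nome_deriv [derivative_intros]:
  "(nome has_field_derivative 2 * of_real pi * \<i> * nome z) (at z)"
  unfolding nome_def by (auto intro!: derivative_eq_intros)

text \<open>On functions of \<open>q = nome z\<close>, differentiation in \<open>z\<close> is
  \<open>2 * pi * i\<close> times \<open>q d/dq\<close>, so the shape persists with \<open>F\<close>
  replaced by \<open>q * F'\<close>.\<close>

lemma Polygamma_reflection_chain:
  fixes F D :: "complex \<Rightarrow> complex"
  assumes "\<And>z. z \<notin> \<int> \<Longrightarrow> (-1) ^ n * Polygamma n (1 - z) - Polygamma n z =
      - ((2 * of_real pi * \<i>) ^ Suc n) * F (nome z)"
    and "\<And>q. q \<noteq> 1 \<Longrightarrow> (F has_field_derivative D q) (at q)" and "z \<notin> \<int>"
  shows "(-1) ^ Suc n * Polygamma (Suc n) (1 - z) - Polygamma (Suc n) z =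
      - ((2 * of_real pi * \<i>) ^ Suc (Suc n)) * (nome z * D (nome z))"
proof (rule Polygamma_reflection_step[OF assms(1)])
  show "((\<lambda>z. - ((2 * of_real pi * \<i>) ^ Suc n) * F (nome z)) has_field_derivative
      - ((2 * of_real pi * \<i>) ^ Suc (Suc n)) * (nome z * D (nome z))) (at z)"
    by (rule derivative_eq_intros DERIV_chain2[OF assms(2)] nome_deriv nome_neq_1 assms(3) refl | simp)+
qed (use assms(3) in simp_all)

text \<open>This is the quotient rule with the common power of \<open>1 - q\<close> cancelled, so
  that repeated derivatives only require computing polynomial numerators.\<close>

lemma DERIV_divide_power:
  fixes P :: "complex \<Rightarrow> complex"
  assumes "(P has_field_derivative P') (at q)" "q \<noteq> 1" "Q = P' * (1 - q) + of_nat k * P q"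
  shows "((\<lambda>q. P q / (1 - q) ^ k) has_field_derivative Q / (1 - q) ^ Suc k) (at q)"
proof (cases k)
  case (Suc m)
  have nz: "1 - q \<noteq> 0" using assms(2) by simp
  have "((\<lambda>q. P q / (1 - q) ^ k) has_field_derivative
      (P' * (1 - q) ^ k - P q * (of_nat k * (1 - q) ^ m * (-1))) / ((1 - q) ^ k * (1 - q) ^ k)) (at q)"
  proof (rule DERIV_divide[OF assms(1)])
    have "((\<lambda>q. 1 - q) has_field_derivative -1) (at q)"
      by (auto intro!: derivative_eq_intros)
    from DERIV_power[OF this, of k]
    show "((\<lambda>q. (1 - q) ^ k) has_field_derivative of_nat k * (1 - q) ^ m * (-1)) (at q)"
      by (simp add: Suc)
  qed (use nz in simp)
  moreover have "P' * (1 - q) ^ k - P q * (of_nat k * (1 - q) ^ m * (-1)) = Q * (1 - q) ^ m"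
    unfolding assms(3) Suc by (simp add: algebra_simps)
  moreover have "Q * (1 - q) ^ m / ((1 - q) ^ k * (1 - q) ^ k) = Q / (1 - q) ^ Suc k"
    using nz by (simp add: Suc)
  ultimately show ?thesis by simp
qed (use assms in auto)

text \<open>The operator \<open>q d/dq\<close> is applied repeatedly to
  \<open>(1 + q) / (2 * (1 - q))\<close>, which comes from the cotangent. The numerators that arise
  are Eulerian polynomials.\<close>

lemma
  fixes z :: complex
  assumes "z \<notin> \<int>"
  shows Polygamma_3_reflection: "Polygamma 3 (1 - z) + Polygamma 3 z = (2 * of_real pi * \<i>) ^ 4 * geom_power3 (nome z)"
    and Polygamma_5_reflection: "Polygamma 5 (1 - z) + Polygamma 5 z = (2 * of_real pi * \<i>) ^ 6 * geom_power5 (nome z)"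
proof -
  define R where "R n F \<longleftrightarrow> (\<forall>z. z \<notin> \<int> \<longrightarrow> (-1) ^ n * Polygamma n (1 - z) - Polygamma n z =
      - ((2 * of_real pi * \<i>) ^ Suc n) * F (nome z))" for n and F :: "complex \<Rightarrow> complex"
  have step: "R (Suc n) (\<lambda>q. q * (Q q / (1 - q) ^ Suc k))"
    if "R n (\<lambda>q. P q / (1 - q) ^ k)" "\<And>q. (P has_field_derivative P' q) (at q)"
      "\<And>q. Q q = P' q * (1 - q) + of_nat k * P q" for n P P' Q k
    unfolding R_def
  proof (intro allI impI)
    fix z :: complex assume z: "z \<notin> \<int>"
    show "(-1) ^ Suc n * Polygamma (Suc n) (1 - z) - Polygamma (Suc n) z =
      - ((2 * of_real pi * \<i>) ^ Suc (Suc n)) * (nome z * (Q (nome z) / (1 - nome z) ^ Suc k))"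
      by (rule Polygamma_reflection_chain[OF _ DERIV_divide_power[OF that(2) _ that(3)] z])
        (use that(1) in \<open>auto simp: R_def\<close>)
  qed
  have "R 0 (\<lambda>q. (1 + q) / 2 / (1 - q) ^ 1)"
    unfolding R_def using Digamma_reflection_complex pi_cot_eq by simp
  then have "R (Suc 0) (\<lambda>q. q * (1 / (1 - q) ^ Suc 1))"
    by (rule step[where P' = "\<lambda>_. 1 / 2"]) (auto intro!: derivative_eq_intros simp: field_simps)
  then have "R 1 (\<lambda>q. q / (1 - q) ^ 2)" by (simp add: numeral_eq_Suc)
  then have "R (Suc 1) (\<lambda>q. q * ((1 + q) / (1 - q) ^ Suc 2))"
    by (rule step[where P' = "\<lambda>_. 1"]) (auto intro!: derivative_eq_intros simp: field_simps)
  then have "R 2 (\<lambda>q. q * (1 + q) / (1 - q) ^ 3)" by (simp add: numeral_eq_Suc)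
  then have "R (Suc 2) (\<lambda>q. q * ((1 + 4 * q + q ^ 2) / (1 - q) ^ Suc 3))"
    by (rule step[where P' = "\<lambda>q. 1 + 2 * q"]) (auto intro!: derivative_eq_intros simp: field_simps power2_eq_square)
  then have 3: "R 3 (\<lambda>q. q * (1 + 4 * q + q ^ 2) / (1 - q) ^ 4)" by (simp add: numeral_eq_Suc)
  then have "R (Suc 3) (\<lambda>q. q * ((1 + 11 * q + 11 * q ^ 2 + q ^ 3) / (1 - q) ^ Suc 4))"
    by (rule step[where P' = "\<lambda>q. 1 + 8 * q + 3 * q ^ 2"])
      (auto intro!: derivative_eq_intros simp: algebra_simps power2_eq_square power3_eq_cube)
  then have "R 4 (\<lambda>q. q * (1 + 11 * q + 11 * q ^ 2 + q ^ 3) / (1 - q) ^ 5)" by (simp add: numeral_eq_Suc)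
  then have "R (Suc 4) (\<lambda>q. q * ((1 + 26 * q + 66 * q ^ 2 + 26 * q ^ 3 + q ^ 4) / (1 - q) ^ Suc 5))"
    by (rule step[where P' = "\<lambda>q. 1 + 22 * q + 33 * q ^ 2 + 4 * q ^ 3"])
      (auto intro!: derivative_eq_intros simp: algebra_simps power2_eq_square power3_eq_cube power4_eq_xxxx)
  then have 5: "R 5 (\<lambda>q. q * (1 + 26 * q + 66 * q ^ 2 + 26 * q ^ 3 + q ^ 4) / (1 - q) ^ 6)" by (simp add: numeral_eq_Suc)
  \<comment> \<open>For odd \<open>k\<close> the left side in \<open>R k F\<close> is minus the sum
    of the two Polygamma values.\<close>
  have "Polygamma k (1 - z) + Polygamma k z = (2 * of_real pi * \<i>) ^ Suc k * F (nome z)"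
    if "R k F" "odd k" for k F
  proof -
    have "- (Polygamma k (1 - z) + Polygamma k z) = - ((2 * of_real pi * \<i>) ^ Suc k * F (nome z))"
      using that assms by (simp add: R_def del: power_Suc)
    then show ?thesis by (rule neg_equal_iff_equal[THEN iffD1])
  qed
  from this[OF 3] this[OF 5]
  show "Polygamma 3 (1 - z) + Polygamma 3 z = (2 * of_real pi * \<i>) ^ 4 * geom_power3 (nome z)"
    and "Polygamma 5 (1 - z) + Polygamma 5 z = (2 * of_real pi * \<i>) ^ 6 * geom_power5 (nome z)"
    by (simp_all add: geom_power3_def geom_power5_def del: power_Suc)
qed

section \<open>Sums of inverse powers over the integers\<close>

lemma summable_on_inverse_power:
  fixes z :: complex
  assumes "m \<ge> 2"
  shows "(\<lambda>k. 1 / (z + of_nat k) ^ m) summable_on (UNIV :: nat set)"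
proof (rule norm_summable_imp_summable_on, rule summable_comparison_test')
  show "summable (\<lambda>k. 2 ^ m * inverse (of_nat k ^ m :: real))"
    using inverse_power_summable[OF assms, where 'a = real] by (intro summable_mult)
  \<comment> \<open>From this index on, \<open>z + k\<close> has norm at least
    \<open>k / 2\<close>.\<close>
  fix k assume k: "k \<ge> nat \<lceil>2 * norm z\<rceil> + 1"
  then have k: "real k \<ge> 2 * norm z" "k > 0" by linarith+
  have "norm (z + of_nat k) \<ge> real k - norm z"
    using norm_triangle_ineq4[of "z + of_nat k" z] by simp
  then have "norm (z + of_nat k) \<ge> real k / 2" using k by simp
  then have "(real k / 2) ^ m \<le> norm (z + of_nat k) ^ m" by (intro power_mono) auto
  then have "1 / norm (z + of_nat k) ^ m \<le> 1 / (real k / 2) ^ m"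
    using k by (intro divide_left_mono mult_pos_pos) (auto intro: order_less_le_trans[of _ "(real k / 2) ^ m"])
  then show "norm (norm (1 / (z + of_nat k) ^ m)) \<le> 2 ^ m * inverse (of_nat k ^ m)"
    by (simp add: norm_divide norm_power power_divide field_simps)
qed

text \<open>Enumerating the negative integers as \<open>- n - 1\<close> turns the shifts of
  \<open>z\<close> by them into shifts of \<open>1 - z\<close> by natural numbers, up to
  sign.\<close>

lemma has_sum_int_split:
  fixes f :: "int \<Rightarrow> 'a :: topological_comm_monoid_add"
  assumes "((\<lambda>n. f (int n)) has_sum a) UNIV" "((\<lambda>n. f (- int n - 1)) has_sum b) UNIV"
  shows "(f has_sum (a + b)) UNIV"
proof -
  have U: "range int \<union> range (\<lambda>n. - int n - 1) = UNIV"
  proof (intro equalityI subsetI)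
    fix x :: int
    show "x \<in> range int \<union> range (\<lambda>n. - int n - 1)"
    proof (cases "x \<ge> 0")
      case True then show ?thesis by (intro UnI1 range_eqI[of _ _ "nat x"]) simp
    next
      case False then show ?thesis by (intro UnI2 range_eqI[of _ _ "nat (- x - 1)"]) simp
    qed
  qed simp
  have "(f has_sum (a + b)) (range int \<union> range (\<lambda>n. - int n - 1))"
  proof (rule has_sum_Un_disjoint)
    show "(f has_sum a) (range int)"
      using assms(1) by (subst has_sum_reindex) (auto simp: inj_on_def o_def)
    show "(f has_sum b) (range (\<lambda>n. - int n - 1))"
      using assms(2) by (subst has_sum_reindex) (auto simp: inj_on_def o_def)
  qed auto
  then show ?thesis unfolding U .
qed

text \<open>The two halves of the sum are the series of \<open>Polygamma m\<close> at
  \<open>z\<close> and at \<open>1 - z\<close>; the exponent \<open>Suc m\<close> is even, which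
  removes the signs.\<close>

lemma has_sum_inverse_power_int:
  fixes z :: complex
  assumes z: "z \<notin> \<int>" and m: "odd m"
  shows "((\<lambda>n. 1 / (z + of_int n) ^ Suc m) has_sum (Polygamma m (1 - z) + Polygamma m z) / fact m) UNIV"
proof -
  have half: "((\<lambda>k. 1 / (w + of_nat k) ^ Suc m) has_sum (Polygamma m w / fact m)) (UNIV :: nat set)"
    if "w \<notin> \<int>" for w :: complex
  proof -
    have "w \<noteq> 0" "Suc m \<ge> 2" using that m by (auto elim: oddE)
    have "(\<lambda>k. 1 / (w + of_nat k) ^ Suc m) summable_on (UNIV :: nat set)"
      using \<open>Suc m \<ge> 2\<close> by (rule summable_on_inverse_power)
    then obtain s where s: "((\<lambda>k. 1 / (w + of_nat k) ^ Suc m) has_sum s) (UNIV :: nat set)"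
      by (auto simp: summable_on_def)
    have "(\<lambda>k. inverse ((w + of_nat k) ^ Suc m)) sums ((-1) ^ Suc m * Polygamma m w / fact m)"
      using \<open>w \<noteq> 0\<close> m by (intro Polygamma_LIMSEQ) (auto elim: oddE)
    then have "(\<lambda>k. 1 / (w + of_nat k) ^ Suc m) sums (Polygamma m w / fact m)"
      using m by (simp add: inverse_eq_divide del: power_Suc of_nat_Suc)
    with has_sum_imp_sums[OF s] have "s = Polygamma m w / fact m" by (rule sums_unique2)
    with s show ?thesis by simp
  qed
  have z1: "1 - z \<notin> \<int>"
    using z Ints_diff[OF Ints_1, of "1 - z"] by auto
  have "((\<lambda>n. 1 / (z + of_int n) ^ Suc m) has_sum (Polygamma m z / fact m + Polygamma m (1 - z) / fact m)) UNIV"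
  proof (rule has_sum_int_split)
    show "((\<lambda>k. 1 / (z + of_int (int k)) ^ Suc m) has_sum (Polygamma m z / fact m)) UNIV"
      using half[OF z] by simp
    have "(z + of_int (- int k - 1)) ^ Suc m = (1 - z + of_nat k) ^ Suc m" for k
    proof -
      have "z + of_int (- int k - 1) = - (1 - z + of_nat k)" by simp
      then show ?thesis using m by (metis even_Suc power_minus_even)
    qed
    then show "((\<lambda>k. 1 / (z + of_int (- int k - 1)) ^ Suc m) has_sum (Polygamma m (1 - z) / fact m)) UNIV"
      using half[OF z1] by (simp del: power_Suc of_int_diff of_int_minus)
  qed
  then show ?thesis by (simp add: add_divide_distrib add.commute)
qed

text \<open>The constant is \<open>(2 * pi * i) ^ 4 / 3!\<close>. Using the closed form in place of
  a power series in \<open>q\<close> makes the formula available at \<open>z = 1 / 2\<close>, where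
  \<open>q = - 1\<close>.\<close>

lemma Lipschitz_formula_4:
  assumes "z \<notin> \<int>"
  shows "((\<lambda>n. 1 / (z + of_int n) ^ 4) has_sum (8 / 3 * of_real pi ^ 4 * geom_power3 (nome z))) UNIV"
  using has_sum_inverse_power_int[OF assms, of 3]
  unfolding Polygamma_3_reflection[OF assms]
  by (simp add: power_mult_distrib fact_numeral field_simps)

text \<open>The constant is \<open>(2 * pi * i) ^ 6 / 5!\<close>.\<close>

lemma Lipschitz_formula_6:
  assumes "z \<notin> \<int>"
  shows "((\<lambda>n. 1 / (z + of_int n) ^ 6) has_sum (- 8 / 15 * of_real pi ^ 6 * geom_power5 (nome z))) UNIV"
  using has_sum_inverse_power_int[OF assms, of 5]
  unfolding Polygamma_5_reflection[OF assms]
  by (simp add: power_mult_distrib fact_numeral field_simps)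

lemma Ints_nonzero_even_odd:
  "(UNIV :: int set) - {0} = range (\<lambda>n. 2 * n + 1) \<union> (\<lambda>n. 2 * n) ` (UNIV - {0})"
proof (intro equalityI subsetI)
  fix x :: int assume "x \<in> UNIV - {0}"
  then show "x \<in> range (\<lambda>n. 2 * n + 1) \<union> (\<lambda>n. 2 * n) ` (UNIV - {0})"
    by (cases "even x") (auto elim!: evenE oddE)
qed (auto, presburger)

text \<open>
  The odd terms are a shifted series at \<open>1 / 2\<close>, the even terms a multiple of the whole sum, so the
  Lipschitz formula at \<open>1 / 2\<close> determines the zeta value.
\<close>

lemma zeta_even_int:
  assumes s: "(\<lambda>n. 1 / of_int n ^ m :: complex) summable_on (UNIV - {0 :: int})"
    and h: "((\<lambda>n. 1 / (1 / 2 + of_int n) ^ m) has_sum (h :: complex)) UNIV" and "m > 0"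
  shows "((\<lambda>n. 1 / of_int n ^ m) has_sum (h / (2 ^ m - 1))) (UNIV - {0 :: int})"
proof -
  obtain Z :: complex where Z: "((\<lambda>n. 1 / of_int n ^ m) has_sum Z) (UNIV - {0 :: int})"
    using s by (auto simp: summable_on_def)
  have "((\<lambda>n :: int. 1 / of_int n ^ m) has_sum (h / 2 ^ m)) (range (\<lambda>n. 2 * n + 1))"
  proof (subst has_sum_reindex)
    have "(\<lambda>n. 1 / (1 / 2 + of_int n) ^ m * (1 / 2 ^ m) :: complex) = (\<lambda>n :: int. 1 / of_int n ^ m) \<circ> (\<lambda>n. 2 * n + 1)"
    proof
      fix n :: int
      have eq: "of_int (2 * n + 1) = 2 * (1 / 2 + of_int n :: complex)" by simp
      show "1 / (1 / 2 + of_int n) ^ m * (1 / 2 ^ m) = ((\<lambda>n :: int. 1 / of_int n ^ m :: complex) \<circ> (\<lambda>n. 2 * n + 1)) n"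
        unfolding o_def eq power_mult_distrib by simp
    qed
    with has_sum_cmult_left[OF h, of "1 / 2 ^ m"]
    show "((\<lambda>n :: int. 1 / of_int n ^ m) \<circ> (\<lambda>n. 2 * n + 1) has_sum (h / 2 ^ m)) UNIV" by simp
  qed (auto simp: inj_on_def)
  moreover have "((\<lambda>n :: int. 1 / of_int n ^ m) has_sum (Z / 2 ^ m)) ((\<lambda>n. 2 * n) ` (UNIV - {0}))"
    using has_sum_cmult_left[OF Z, of "1 / 2 ^ m"]
    by (subst has_sum_reindex) (auto simp: inj_on_def o_def power_mult_distrib mult.commute)
  moreover have "range (\<lambda>n :: int. 2 * n + 1) \<inter> (\<lambda>n. 2 * n) ` (UNIV - {0}) = {}"
    by auto presburger
  ultimately have "((\<lambda>n :: int. 1 / of_int n ^ m) has_sum (h / 2 ^ m + Z / 2 ^ m)) (UNIV - {0})"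
    by (subst Ints_nonzero_even_odd) (rule has_sum_Un_disjoint)
  from has_sum_unique[OF Z this] have "Z = h / 2 ^ m + Z / 2 ^ m" .
  then have "Z * (2 ^ m - 1) = h" by (simp add: divide_simps) (simp add: algebra_simps)
  moreover have "norm ((2 :: complex) ^ m) > 1"
    using \<open>m > 0\<close> by (simp only: norm_power) simp
  then have "(2 :: complex) ^ m - 1 \<noteq> 0" by auto
  ultimately have "Z = h / (2 ^ m - 1)" by (metis nonzero_mult_div_cancel_right)
  with Z show ?thesis by simp
qed

subsection \<open>Eisenstein series\<close>

text \<open>The imaginary part of \<open>a * z + b\<close> controls \<open>a\<close>, and then the
  triangle inequality controls \<open>b\<close>.\<close>

lemma lattice_norm_bound:
  assumes "Im z > 0"
  obtains c where "c > 0" "\<And>a b :: real. c * (a ^ 2 + b ^ 2) \<le> norm (of_real a * z + of_real b) ^ 2"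
proof
  define K where "K = (1 / Im z) ^ 2 + (1 + norm z / Im z) ^ 2"
  have K: "K > 0" unfolding K_def using assms by (intro add_pos_nonneg) auto
  then show "1 / K > 0" by simp
  fix a b :: real
  let ?N = "norm (of_real a * z + of_real b)"
  have "\<bar>a\<bar> * Im z \<le> ?N"
    using abs_Im_le_cmod[of "of_real a * z + of_real b"] assms by (simp add: abs_mult)
  then have a: "\<bar>a\<bar> \<le> ?N * (1 / Im z)" using assms by (simp add: field_simps)
  have "\<bar>b\<bar> \<le> ?N + \<bar>a\<bar> * norm z"
    using norm_triangle_ineq4[of "of_real a * z + of_real b" "of_real a * z"] by (simp add: norm_mult)
  also have "\<dots> \<le> ?N + ?N * (1 / Im z) * norm z" using a by (intro add_mono mult_right_mono) auto
  finally have b: "\<bar>b\<bar> \<le> ?N * (1 + norm z / Im z)" by (simp add: field_simps)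
  have "a ^ 2 \<le> ?N ^ 2 * (1 / Im z) ^ 2" "b ^ 2 \<le> ?N ^ 2 * (1 + norm z / Im z) ^ 2"
    using power_mono[OF a, of 2] power_mono[OF b, of 2] by (simp_all only: power2_abs abs_ge_zero power_mult_distrib)
  then have "a ^ 2 + b ^ 2 \<le> ?N ^ 2 * K" unfolding K_def distrib_left by linarith
  then show "1 / K * (a ^ 2 + b ^ 2) \<le> ?N ^ 2" using K by (simp add: field_simps)
qed

lemma summable_on_inverse_square_int: "(\<lambda>a :: int. 1 / (1 + of_int a ^ 2) :: real) summable_on UNIV"
proof -
  have *: "(\<lambda>n. 1 / (1 + of_int (f n) ^ 2) :: real) summable_on (UNIV :: nat set)"
    if "\<And>n. \<bar>f n\<bar> \<ge> int n" for f
  proof (rule norm_summable_imp_summable_on, rule summable_comparison_test')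
    show "summable (\<lambda>k. inverse (of_nat k ^ 2 :: real))" by (rule inverse_power_summable) simp
    fix n :: nat assume "n \<ge> 1"
    have "real n ^ 2 \<le> of_int (f n) ^ 2"
      using that[of n] by (metis abs_le_square_iff abs_of_nat of_int_abs of_int_le_iff of_int_of_nat_eq)
    then show "norm (norm (1 / (1 + of_int (f n) ^ 2) :: real)) \<le> inverse (of_nat n ^ 2)"
      using \<open>n \<ge> 1\<close> by (simp add: inverse_eq_divide frac_le)
  qed
  show ?thesis
    using has_sum_int_split[of "\<lambda>a. 1 / (1 + of_int a ^ 2) :: real"] *[of int] *[of "\<lambda>n. - int n - 1"]
    by (auto simp: summable_on_def simp del: of_int_diff of_int_minus)
qed

text \<open>With \<open>s = a ^ 2 + b ^ 2 \<ge> 1\<close> one has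
  \<open>(1 + a ^ 2) * (1 + b ^ 2) \<le> 3 * s ^ k\<close>, so the terms are dominated by a product
  of two convergent one-variable series.\<close>

lemma lattice_abs_summable:
  assumes "Im z > 0" "k \<ge> 2"
  shows "(\<lambda>p. norm (case p of (a, b) \<Rightarrow> 1 / (of_int a * z + of_int b) ^ (2 * k))) summable_on (UNIV - {(0 :: int, 0 :: int)})"
proof -
  obtain c where c: "c > 0" "\<And>a b :: real. c * (a ^ 2 + b ^ 2) \<le> norm (of_real a * z + of_real b) ^ 2"
    using lattice_norm_bound[OF assms(1)] by blast
  define g :: "int \<Rightarrow> real" where "g a = 1 / (1 + of_int a ^ 2)" for a
  have g: "g summable_on UNIV" "\<And>a. g a \<ge> 0"
    using summable_on_inverse_square_int by (simp_all add: g_def[abs_def])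
  have "(\<lambda>p. norm (case p of (a, b) \<Rightarrow> g a * g b)) summable_on (UNIV \<times> UNIV)"
    using g by (intro Infinite_Sum.abs_summable_on_Sigma_iff[THEN iffD2])
      (auto simp: abs_mult infsum_cmult_right' intro!: summable_on_cmult_right summable_on_cmult_left infsum_nonneg)
  then have "(\<lambda>p. norm (case p of (a, b) \<Rightarrow> g a * g b)) summable_on (UNIV - {(0, 0)})"
    by (rule summable_on_subset_banach) auto
  from summable_on_cmult_right[OF this, of "norm (3 / c ^ k)"]
  have "(\<lambda>p. norm (3 / c ^ k * (case p of (a, b) \<Rightarrow> g a * g b))) summable_on (UNIV - {(0, 0)})"
    by (simp only: norm_mult)
  then show ?thesis
  proof (rule Infinite_Sum.abs_summable_on_comparison_test)
    fix p :: "int \<times> int" assume p: "p \<in> UNIV - {(0, 0)}"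
    obtain a b where ab: "p = (a, b)" by force
    define s :: real where "s = of_int a ^ 2 + of_int b ^ 2"
    have "a ^ 2 + b ^ 2 \<ge> 1"
      using p ab by (metis Diff_iff UNIV_I insertI1 int_one_le_iff_zero_less sum_power2_gt_zero_iff)
    then have "real_of_int (a ^ 2 + b ^ 2) \<ge> 1" by linarith
    then have s: "s \<ge> 1" by (simp add: s_def)
    have "(1 + real_of_int a ^ 2) * (1 + of_int b ^ 2) = 1 + s + of_int a ^ 2 * of_int b ^ 2"
      by (simp add: s_def algebra_simps)
    also have "of_int a ^ 2 * of_int b ^ 2 \<le> s * s"
      unfolding s_def by (intro mult_mono) auto
    also have "1 + s + s * s \<le> 3 * s ^ 2"
    proof -
      have "0 \<le> (s - 1) * (2 * s + 1)" using s by simp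
      then show ?thesis by (simp add: power2_eq_square algebra_simps)
    qed
    also have "s ^ 2 \<le> s ^ k" using s assms by (intro power_increasing) auto
    finally have prod: "(1 + real_of_int a ^ 2) * (1 + of_int b ^ 2) \<le> 3 * s ^ k" by simp
    have "c ^ k * s ^ k = (c * s) ^ k" by (simp add: power_mult_distrib)
    also have "\<dots> \<le> (norm (of_int a * z + of_int b) ^ 2) ^ k"
      using c(2)[of "of_int a" "of_int b"] c(1) s by (intro power_mono) (auto simp: s_def)
    also have "\<dots> = norm (of_int a * z + of_int b) ^ (2 * k)" by (simp add: power_mult)
    finally have n: "c ^ k * s ^ k \<le> norm (of_int a * z + of_int b) ^ (2 * k)" .
    have pos: "(1 + real_of_int a ^ 2) * (1 + of_int b ^ 2) > 0" "c ^ k * s ^ k > 0"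
      using c s by (auto intro!: mult_pos_pos add_pos_nonneg)
    have "1 / norm (of_int a * z + of_int b) ^ (2 * k) \<le> 1 / (c ^ k * s ^ k)"
      using n pos by (intro frac_le) auto
    also have "\<dots> = 3 / c ^ k * (1 / (3 * s ^ k))" by simp
    also have "\<dots> \<le> 3 / c ^ k * (1 / ((1 + real_of_int a ^ 2) * (1 + of_int b ^ 2)))"
      using prod pos c by (intro mult_left_mono frac_le) auto
    finally show "norm (case p of (a, b) \<Rightarrow> 1 / (of_int a * z + of_int b) ^ (2 * k))
        \<le> norm (3 / c ^ k * (case p of (a, b) \<Rightarrow> g a * g b))"
      using c(1) by (simp add: ab g_def norm_divide norm_power)
  qed
qed

section \<open>Expansions of the Eisenstein series in \<open>q\<close>\<close>

lemma has_sum_insert_0_Suc: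
  fixes f :: "nat \<Rightarrow> 'a :: topological_comm_monoid_add"
  assumes "((\<lambda>n. f (Suc n)) has_sum s) UNIV"
  shows "(f has_sum (f 0 + s)) UNIV"
proof -
  have "(f has_sum s) (range Suc)"
    using assms by (subst has_sum_reindex) (simp_all add: o_def)
  moreover have "(f has_sum f 0) {0}" using has_sum_finite[of "{0}" f] by simp
  ultimately have "(f has_sum (f 0 + s)) ({0} \<union> range Suc)"
    by (intro has_sum_Un_disjoint) auto
  then show ?thesis by (subst UNIV_nat_eq) simp
qed

lemma nome_of_nat_mult: "nome (of_nat n * z) = nome z ^ n"
proof -
  have "2 * of_real pi * \<i> * (of_nat n * z) = of_nat n * (2 * of_real pi * \<i> * z)" by simp
  then show ?thesis unfolding nome_def by (metis exp_of_nat_mult)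
qed

text \<open>The lattice sum is evaluated row by row in \<open>a\<close>. The row
  \<open>a = 0\<close> is a zeta value, found from \<open>L\<close> at \<open>1 / 2\<close>, where
  \<open>nome\<close> is \<open>- 1\<close>; the other rows come from \<open>L\<close> at multiples
  of \<open>z\<close>, and rows \<open>a\<close> and \<open>- a\<close> agree.\<close>

lemma eisenstein_G_eq:
  fixes F :: "complex \<Rightarrow> complex"
  assumes z: "Im z > 0" and k: "k \<ge> 2" and "C \<noteq> 0"
    and L: "\<And>w. w \<notin> \<int> \<Longrightarrow> ((\<lambda>n. 1 / (w + of_int n) ^ (2 * k)) has_sum (C * F (nome w))) UNIV"
  shows "eisenstein_G (2 * k) z = C * F (- 1) / (2 ^ (2 * k) - 1) + 2 * C * (\<Sum>n. F (nome z ^ Suc n))"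
proof -
  define Z where "Z = C * F (- 1) / (2 ^ (2 * k) - 1)"
  define f where "f = (\<lambda>(a, b). 1 / (of_int a * z + of_int b) ^ (2 * k))"
  \<comment> \<open>The fibre over \<open>a = 0\<close> omits the origin of the lattice.\<close>
  define B where "B = (\<lambda>a :: int. if a = 0 then UNIV - {0} else UNIV :: int set)"
  define g where "g a = (if a = 0 then Z else C * F (nome (of_int \<bar>a\<bar> * z)))" for a :: int
  have S: "UNIV - {(0 :: int, 0 :: int)} = Sigma UNIV B" by (auto simp: B_def split: if_splits)
  have "(\<lambda>p. norm (f p)) summable_on (Sigma UNIV B)"
    using lattice_abs_summable[OF z k] by (simp add: S f_def)
  then have sum: "f summable_on (Sigma UNIV B)" by (rule abs_summable_summable)
  then have G: "(f has_sum eisenstein_G (2 * k) z) (Sigma UNIV B)"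
    unfolding eisenstein_G_def S[symmetric] f_def by (rule has_sum_infsum)
  have nInt: "of_int a * z \<notin> \<int>" if "a \<noteq> 0" for a :: int
    using that z by (auto simp: complex_is_Int_iff)
  have inner: "((\<lambda>b. f (a, b)) has_sum g a) (B a)" for a
  proof (cases "a = 0")
    case True
    have half: "(1 / 2 :: complex) \<notin> \<int>"
    proof
      assume "(1 / 2 :: complex) \<in> \<int>"
      then obtain n :: int where "1 / 2 = (of_int n :: complex)" by (auto elim: Ints_cases)
      then have "of_int (2 * n) = (of_int 1 :: complex)" by (simp add: field_simps)
      then have "2 * n = 1" by (simp only: of_int_eq_iff)
      then show False by presburger
    qed
    have "nome (1 / 2) = - 1" by (simp add: nome_def exp_pi_i)
    with L[OF half] have "((\<lambda>n. 1 / (1 / 2 + of_int n) ^ (2 * k)) has_sum (C * F (- 1))) UNIV" by simp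
    moreover have "(\<lambda>n. 1 / of_int n ^ (2 * k) :: complex) summable_on (UNIV - {0 :: int})"
    proof -
      have "(\<lambda>b. f (0, b)) summable_on (B 0)"
        using summable_on_SigmaD1[of "\<lambda>x y. f (x, y)" UNIV B 0] sum by simp
      then show ?thesis by (simp add: f_def B_def)
    qed
    ultimately have "((\<lambda>n. 1 / of_int n ^ (2 * k)) has_sum Z) (UNIV - {0 :: int})"
      unfolding Z_def using k by (intro zeta_even_int) auto
    then show ?thesis by (simp add: True f_def B_def g_def)
  next
    case False
    have *: "((\<lambda>b. f (\<bar>a\<bar>, b)) has_sum g a) UNIV"
      using L[OF nInt[of "\<bar>a\<bar>"]] False by (simp add: f_def g_def)
    have "((\<lambda>b. f (a, b)) has_sum g a) UNIV"
    proof (cases "a > 0")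
      case neg: False
      \<comment> \<open>Reversing \<open>b\<close> turns the row of \<open>\<bar>a\<bar>\<close>
        into the row of a negative \<open>a\<close>, because the exponent is even.\<close>
      have "bij_betw uminus (UNIV :: int set) UNIV"
        by (rule bij_betwI[of _ _ _ uminus]) auto
      from has_sum_reindex_bij_betw[OF this, of "\<lambda>b. f (\<bar>a\<bar>, b)"] *
      have "((\<lambda>b. f (\<bar>a\<bar>, - b)) has_sum g a) UNIV" by simp
      moreover have "f (\<bar>a\<bar>, - b) = f (a, b)" for b
      proof -
        have "of_int \<bar>a\<bar> * z + of_int (- b) = - (of_int a * z + of_int b)" using neg by simp
        then show ?thesis unfolding f_def by (simp only: prod.case power_mult power2_minus)
      qed
      ultimately show ?thesis by simp
    qed (use * in simp)
    then show ?thesis using False by (simp add: B_def)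
  qed
  have gsum: "(g has_sum eisenstein_G (2 * k) z) UNIV"
    using has_sum_SigmaD[OF G] inner by blast
  then have "g summable_on range (\<lambda>n. - int n - 1)"
    by (meson summable_on_def summable_on_subset_banach subset_UNIV)
  then have "(\<lambda>n. g (- int n - 1)) summable_on UNIV"
    by (subst (asm) summable_on_reindex) (auto simp: inj_on_def o_def)
  then obtain s where s: "((\<lambda>n. g (- int n - 1)) has_sum s) UNIV" by (auto simp: summable_on_def)
  \<comment> \<open>Positive and negative rows contribute the same terms, hence the factor 2 in the
    result.\<close>
  have ge: "g (- int n - 1) = C * F (nome z ^ Suc n)" "g (int (Suc n)) = C * F (nome z ^ Suc n)" for n
  proof -
    have "complex_of_int \<bar>- int n - 1\<bar> = of_nat (Suc n)" "complex_of_int \<bar>int (Suc n)\<bar> = of_nat (Suc n)"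
      by simp_all
    then show "g (- int n - 1) = C * F (nome z ^ Suc n)" "g (int (Suc n)) = C * F (nome z ^ Suc n)"
      unfolding g_def by (simp_all only: nome_of_nat_mult) simp_all
  qed
  have "((\<lambda>n. g (int n)) has_sum (g (int 0) + s)) UNIV"
    using s by (intro has_sum_insert_0_Suc) (simp only: ge)
  from has_sum_unique[OF has_sum_int_split[OF this s] gsum]
  have "eisenstein_G (2 * k) z = Z + 2 * s" by (simp add: g_def algebra_simps)
  moreover have "(\<lambda>n. C * F (nome z ^ Suc n)) sums s"
    using has_sum_imp_sums[OF s] by (simp only: ge)
  then have "(\<lambda>n. F (nome z ^ Suc n)) sums (s / C)"
    using \<open>C \<noteq> 0\<close> sums_mult_iff[of C "\<lambda>n. F (nome z ^ Suc n)" "s / C"] by simp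
  then have "s = C * (\<Sum>n. F (nome z ^ Suc n))" using \<open>C \<noteq> 0\<close> by (simp add: sums_iff)
  ultimately show ?thesis by (simp add: Z_def)
qed

text \<open>For \<open>|q| < 1\<close> this is the Lambert series with coefficients sigma_3, so that
  \<open>1 + 240 * lambert3 q\<close> is the normalised Eisenstein series \<open>E4\<close>;
  likewise \<open>1 - 504 * lambert5 q\<close> is \<open>E6\<close>.\<close>

definition lambert3 :: "complex \<Rightarrow> complex" where
  "lambert3 q = (\<Sum>n. geom_power3 (q ^ Suc n))"

definition lambert5 :: "complex \<Rightarrow> complex" where
  "lambert5 q = (\<Sum>n. geom_power5 (q ^ Suc n))"

text \<open>The leading factor is \<open>2 * zeta(4)\<close>.\<close>

lemma eisenstein_G_4_eq:
  assumes "Im z > 0"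
  shows "eisenstein_G 4 z = of_real pi ^ 4 / 45 * (1 + 240 * lambert3 (nome z))"
proof -
  have "eisenstein_G (2 * 2) z = 8 / 3 * of_real pi ^ 4 * geom_power3 (- 1) / (2 ^ (2 * 2) - 1) +
      2 * (8 / 3 * of_real pi ^ 4) * lambert3 (nome z)"
    unfolding lambert3_def by (rule eisenstein_G_eq[OF assms]) (use Lipschitz_formula_4 in simp_all)
  moreover have "geom_power3 (- 1) = 1 / 8" by (simp add: geom_power3_def)
  ultimately show ?thesis by (simp add: distrib_left)
qed

text \<open>The leading factor is \<open>2 * zeta(6)\<close>.\<close>

lemma eisenstein_G_6_eq:
  assumes "Im z > 0"
  shows "eisenstein_G 6 z = 2 * of_real pi ^ 6 / 945 * (1 - 504 * lambert5 (nome z))"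
proof -
  have "eisenstein_G (2 * 3) z = - 8 / 15 * of_real pi ^ 6 * geom_power5 (- 1) / (2 ^ (2 * 3) - 1) +
      2 * (- 8 / 15 * of_real pi ^ 6) * lambert5 (nome z)"
    unfolding lambert5_def by (rule eisenstein_G_eq[OF assms]) (use Lipschitz_formula_6 in simp_all)
  moreover have "geom_power5 (- 1) = - 1 / 4" by (simp add: geom_power5_def)
  ultimately show ?thesis by (simp add: right_diff_distrib)
qed

text \<open>Both \<open>g2 ^ 3\<close> and \<open>27 * g3 ^ 2\<close> carry the factor
  \<open>64 / 27 * pi ^ 12\<close>, which cancels.\<close>

lemma modular_j_eq:
  assumes "Im z > 0"
  defines "E4 \<equiv> 1 + 240 * lambert3 (nome z)" and "E6 \<equiv> 1 - 504 * lambert5 (nome z)"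
  shows "modular_j z = 1728 * E4 ^ 3 / (E4 ^ 3 - E6 ^ 2)"
proof -
  have "modular_j z = (64 / 27 * of_real pi ^ 12 * (1728 * E4 ^ 3)) / (64 / 27 * of_real pi ^ 12 * (E4 ^ 3 - E6 ^ 2))"
    unfolding modular_j_def modular_g2_def modular_g3_def eisenstein_G_4_eq[OF assms(1)] eisenstein_G_6_eq[OF assms(1)]
      E4_def[symmetric] E6_def[symmetric]
    by (rule arg_cong2[where f = "(/)"])
      (simp_all add: power_mult_distrib power_divide power_mult [symmetric] right_diff_distrib mult_ac)
  also have "\<dots> = 1728 * E4 ^ 3 / (E4 ^ 3 - E6 ^ 2)"
    by (rule mult_divide_mult_cancel_left) simp
  finally show ?thesis .
qed

section \<open>Invariance under the modular group\<close>

text \<open>The integer matrix permutes the nonzero pairs \<open>(m, k)\<close>, and an unordered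
  sum can be reindexed along this bijection.\<close>

lemma eisenstein_G_modular:
  fixes a b c d :: int
  assumes "a * d - b * c = 1" and nz: "of_int c * w + of_int d \<noteq> 0"
  shows "eisenstein_G n ((of_int a * w + of_int b) / (of_int c * w + of_int d)) =
    (of_int c * w + of_int d) ^ n * eisenstein_G n w"
proof -
  let ?j = "of_int c * w + of_int d"
  \<comment> \<open>These identities say that the matrix and its adjugate are inverse to each other
    on row vectors.\<close>
  have inv1: "(m * a + k * c) * d - (m * b + k * d) * c = m"
    "(m * b + k * d) * a - (m * a + k * c) * b = k" for m k
    using assms(1) by algebra+
  have inv2: "(p * d - r * c) * a + (r * a - p * b) * c = p" "(p * d - r * c) * b + (r * a - p * b) * d = r" for p r
    using assms(1) by algebra+
  have "eisenstein_G n ((of_int a * w + of_int b) / ?j) =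
     (\<Sum>\<^sub>\<infinity>(m, k) \<in> UNIV - {(0, 0)}. ?j ^ n * (1 / (of_int m * w + of_int k) ^ n))"
    unfolding eisenstein_G_def
  proof (rule infsum_reindex_bij_witness[where i = "\<lambda>(p, r). (p * d - r * c, r * a - p * b)"
        and j = "\<lambda>(m, k). (m * a + k * c, m * b + k * d)"])
    fix p :: "int \<times> int" assume p: "p \<in> UNIV - {(0, 0)}"
    obtain m k where mk: "p = (m, k)" by force
    show "(\<lambda>(p, r). (p * d - r * c, r * a - p * b)) ((\<lambda>(m, k). (m * a + k * c, m * b + k * d)) p) = p"
      using inv1 by (simp add: mk)
    show "(\<lambda>(m, k). (m * a + k * c, m * b + k * d)) p \<in> UNIV - {(0, 0)}"
      using inv1[of m k] p by (auto simp: mk)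
    show "(\<lambda>(m, k). (m * a + k * c, m * b + k * d)) ((\<lambda>(p, r). (p * d - r * c, r * a - p * b)) p) = p"
      using inv2 by (simp add: mk)
    show "(\<lambda>(p, r). (p * d - r * c, r * a - p * b)) p \<in> UNIV - {(0, 0)}"
      using inv2[of m k] p by (auto simp: mk)
    have "of_int m * ((of_int a * w + of_int b) / ?j) + of_int k =
        (of_int (m * a + k * c) * w + of_int (m * b + k * d)) / ?j"
      using nz by (simp add: field_simps)
    then show "(case (\<lambda>(m, k). (m * a + k * c, m * b + k * d)) p of (m, k) \<Rightarrow> ?j ^ n * (1 / (of_int m * w + of_int k) ^ n)) =
        (case p of (m, k) \<Rightarrow> 1 / (of_int m * ((of_int a * w + of_int b) / ?j) + of_int k) ^ n)"
      by (simp add: mk power_divide)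
  qed
  also have "\<dots> = (\<Sum>\<^sub>\<infinity>p \<in> UNIV - {(0, 0)}. ?j ^ n * (case p of (m, k) \<Rightarrow> 1 / (of_int m * w + of_int k) ^ n))"
    by (simp only: case_prod_unfold)
  also have "\<dots> = ?j ^ n * eisenstein_G n w"
    unfolding eisenstein_G_def by (rule infsum_cmult_right')
  finally show ?thesis .
qed

text \<open>Numerator and denominator both have weight 12, so the automorphy factors cancel.\<close>

lemma modular_j_modular:
  fixes a b c d :: int
  assumes "a * d - b * c = 1" and nz: "of_int c * w + of_int d \<noteq> 0"
  shows "modular_j ((of_int a * w + of_int b) / (of_int c * w + of_int d)) = modular_j w"
proof -
  define j where "j = of_int c * w + of_int d"
  define g2 g3 where "g2 = modular_g2 w" "g3 = modular_g3 w"
  have "modular_g2 ((of_int a * w + of_int b) / j) = j ^ 4 * g2" "modular_g3 ((of_int a * w + of_int b) / j) = j ^ 6 * g3"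
    unfolding modular_g2_def modular_g3_def g2_g3_def j_def eisenstein_G_modular[OF assms] by simp_all
  then have "modular_j ((of_int a * w + of_int b) / j) = (j ^ 12 * (1728 * g2 ^ 3)) / (j ^ 12 * (g2 ^ 3 - 27 * g3 ^ 2))"
    unfolding modular_j_def by (simp add: power_mult_distrib right_diff_distrib mult_ac flip: power_mult)
  also have "\<dots> = 1728 * g2 ^ 3 / (g2 ^ 3 - 27 * g3 ^ 2)"
    using nz by (intro mult_divide_mult_cancel_left) (simp add: j_def)
  finally show ?thesis by (simp add: modular_j_def g2_g3_def j_def)
qed

subsection \<open>Estimates on the disc of radius 1/210\<close>

text \<open>Applied repeatedly to a polynomial in Horner form, this rule computes a numerical bound
  from the absolute values of the coefficients.\<close>

lemma norm_Horner:
  fixes q :: complex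
  assumes "norm p \<le> P" "norm q \<le> 1 / 210"
  shows "norm (c + q * p) \<le> norm c + P / 210"
proof -
  have "norm (q * p) \<le> 1 / 210 * P" unfolding norm_mult using assms by (intro mult_mono) auto
  then show ?thesis by (intro order_trans[OF norm_triangle_ineq]) auto
qed

text \<open>On the disc \<open>|1 - q| \<ge> 209 / 210\<close>. The bound \<open>P\<close> is filled
  in by \<open>norm_Horner\<close>, which leaves a purely numerical inequality.\<close>

lemma norm_divide_one_minus_power:
  fixes q :: complex
  assumes "norm q \<le> 1 / 210" "norm p \<le> P" "P \<le> R * (209 / 210) ^ k"
  shows "norm (p / (1 - q) ^ k) \<le> R"
proof -
  have "209 / 210 \<le> norm (1 - q)" using norm_triangle_ineq2[of 1 q] assms(1) by simp
  then have "(209 / 210) ^ k \<le> norm (1 - q) ^ k" by (intro power_mono) auto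
  have "0 \<le> R * (209 / 210) ^ k" using assms(2,3) norm_ge_zero[of p] by linarith
  moreover have "(209 / 210 :: real) ^ k > 0" by simp
  ultimately have "0 \<le> R" by (metis mult_less_0_iff not_le)
  then have "P \<le> R * norm (1 - q) ^ k"
    using assms(3) mult_left_mono[OF \<open>(209 / 210) ^ k \<le> norm (1 - q) ^ k\<close>] by fastforce
  then have "norm p \<le> R * norm (1 - q) ^ k" using assms(2) by simp
  moreover have "norm (1 - q) > 0" using \<open>209 / 210 \<le> norm (1 - q)\<close> by linarith
  ultimately show ?thesis by (simp add: norm_divide norm_power pos_divide_le_eq)
qed

lemma one_minus_nonzero: "norm (q :: complex) \<le> 1 / 210 \<Longrightarrow> 1 - q \<noteq> 0"
  by auto

text \<open>The next coefficient of the series is \<open>2 ^ 3 = 8\<close>, and 9 leaves room for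
  the rest.\<close>

lemma geom_power3_bound:
  assumes "norm q \<le> 1 / 210"
  shows "norm (geom_power3 q - q) \<le> 9 * norm q ^ 2"
proof -
  have eq: "geom_power3 q - q = q ^ 2 * ((8 + q * (- 5 + q * (4 + q * (- 1)))) / (1 - q) ^ 4)"
    using one_minus_nonzero[OF assms] unfolding geom_power3_def
    by (simp add: divide_simps) (simp add: algebra_simps power_numeral_reduce)
  have "norm ((8 + q * (- 5 + q * (4 + q * (- 1)))) / (1 - q) ^ 4) \<le> 9"
    by (rule norm_divide_one_minus_power[OF assms], (rule norm_Horner assms order_refl)+) (simp add: power_divide)
  from mult_left_mono[OF this, of "norm q ^ 2"] show ?thesis
    unfolding eq norm_mult norm_power by (simp only: mult.commute zero_le_power2)
qed

text \<open>The next coefficient is \<open>2 ^ 5 = 32\<close>, and 34 leaves room for the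
  rest.\<close>

lemma geom_power5_bound:
  assumes "norm q \<le> 1 / 210"
  shows "norm (geom_power5 q - q) \<le> 34 * norm q ^ 2"
proof -
  have eq: "geom_power5 q - q = q ^ 2 * ((32 + q * (51 + q * (46 + q * (- 14 + q * (6 + q * (- 1)))))) / (1 - q) ^ 6)"
    using one_minus_nonzero[OF assms] unfolding geom_power5_def
    by (simp add: divide_simps) (simp add: algebra_simps power_numeral_reduce)
  have "norm ((32 + q * (51 + q * (46 + q * (- 14 + q * (6 + q * (- 1)))))) / (1 - q) ^ 6) \<le> 34"
    by (rule norm_divide_one_minus_power[OF assms], (rule norm_Horner assms order_refl)+) (simp add: power_divide)
  from mult_left_mono[OF this, of "norm q ^ 2"] show ?thesis
    unfolding eq norm_mult norm_power by (simp only: mult.commute zero_le_power2)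
qed

text \<open>This is the mean value inequality for \<open>f q - q\<close> on a disc, which is
  convex.\<close>

lemma near_identity_of_deriv:
  fixes f :: "complex \<Rightarrow> complex"
  assumes "\<And>q. norm q \<le> r \<Longrightarrow> (f has_field_derivative 1 + e q) (at q)" "\<And>q. norm q \<le> r \<Longrightarrow> norm (e q) \<le> B"
    and "norm x \<le> r" "norm y \<le> r"
  shows "norm ((f x - f y) - (x - y)) \<le> B * norm (x - y)"
proof -
  have "norm ((f x - x) - (f y - y)) \<le> B * norm (x - y)"
  proof (rule field_differentiable_bound[where S = "cball 0 r" and f' = e])
    fix q :: complex assume "q \<in> cball 0 r"
    then have q: "norm q \<le> r" by simp
    show "((\<lambda>q. f q - q) has_field_derivative e q) (at q within cball 0 r)"
      by (rule has_field_derivative_at_within) (auto intro!: derivative_eq_intros assms(1)[OF q])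
    show "norm (e q) \<le> B" using assms(2)[OF q] .
  qed (use assms in auto)
  then show ?thesis by (simp add: algebra_simps)
qed

lemma geom_power3_near_identity:
  assumes "norm x \<le> 1 / 210" "norm y \<le> 1 / 210"
  shows "norm ((geom_power3 x - geom_power3 y) - (x - y)) \<le> 1 / 2 * norm (x - y)"
proof (rule near_identity_of_deriv[OF _ _ assms])
  fix q :: complex assume q: "norm q \<le> 1 / 210"
  \<comment> \<open>This is the derivative minus 1; the numerator
    \<open>1 + 11 * q + 11 * q ^ 2 + q ^ 3 - (1 - q) ^ 5\<close> is written in Horner form.\<close>
  let ?e = "(0 + q * (16 + q * (1 + q * (11 + q * (- 5 + q * 1))))) / (1 - q) ^ 5"
  have nz: "1 - q \<noteq> 0" using q by (rule one_minus_nonzero)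
  have "((\<lambda>q. q * (1 + 4 * q + q ^ 2) / (1 - q) ^ 4) has_field_derivative
      (1 + 11 * q + 11 * q ^ 2 + q ^ 3) / (1 - q) ^ Suc 4) (at q)"
    by (rule DERIV_divide_power[where P' = "1 + 8 * q + 3 * q ^ 2"])
      (use nz in \<open>auto intro!: derivative_eq_intros simp: algebra_simps power_numeral_reduce\<close>)
  moreover have "(1 + 11 * q + 11 * q ^ 2 + q ^ 3) / (1 - q) ^ Suc 4 = 1 + ?e"
    using nz by (simp add: divide_simps) (simp add: algebra_simps power_numeral_reduce)
  ultimately show "(geom_power3 has_field_derivative 1 + ?e) (at q)"
    unfolding geom_power3_def[abs_def] by simp
  show "norm ?e \<le> 1 / 2"
    by (rule norm_divide_one_minus_power[OF q], (rule norm_Horner q order_refl)+) (simp add: power_divide)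
qed

lemma geom_power5_near_identity:
  assumes "norm x \<le> 1 / 210" "norm y \<le> 1 / 210"
  shows "norm ((geom_power5 x - geom_power5 y) - (x - y)) \<le> 1 / 2 * norm (x - y)"
proof (rule near_identity_of_deriv[OF _ _ assms])
  fix q :: complex assume q: "norm q \<le> 1 / 210"
  \<comment> \<open>Again the derivative minus 1, with its numerator in Horner form.\<close>
  let ?e = "(0 + q * (64 + q * (281 + q * (337 + q * (22 + q * (22 + q * (- 7 + q * 1))))))) / (1 - q) ^ 7"
  have nz: "1 - q \<noteq> 0" using q by (rule one_minus_nonzero)
  have "((\<lambda>q. q * (1 + 26 * q + 66 * q ^ 2 + 26 * q ^ 3 + q ^ 4) / (1 - q) ^ 6) has_field_derivative
      (1 + 57 * q + 302 * q ^ 2 + 302 * q ^ 3 + 57 * q ^ 4 + q ^ 5) / (1 - q) ^ Suc 6) (at q)"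
    by (rule DERIV_divide_power[where P' = "1 + 52 * q + 198 * q ^ 2 + 104 * q ^ 3 + 5 * q ^ 4"])
      (use nz in \<open>auto intro!: derivative_eq_intros simp: algebra_simps power_numeral_reduce\<close>)
  moreover have "(1 + 57 * q + 302 * q ^ 2 + 302 * q ^ 3 + 57 * q ^ 4 + q ^ 5) / (1 - q) ^ Suc 6 = 1 + ?e"
    using nz by (simp add: divide_simps) (simp add: algebra_simps power_numeral_reduce)
  ultimately show "(geom_power5 has_field_derivative 1 + ?e) (at q)"
    unfolding geom_power5_def[abs_def] by simp
  show "norm ?e \<le> 1 / 2"
    by (rule norm_divide_one_minus_power[OF q], (rule norm_Horner q order_refl)+) (simp add: power_divide)
qed

section \<open>Lambert series as perturbations of the identity\<close>

lemma norm_power_diff_le: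
  fixes x y :: complex
  assumes "norm x \<le> r" "norm y \<le> r"
  shows "norm (x ^ Suc n - y ^ Suc n) \<le> of_nat (Suc n) * r ^ n * norm (x - y)"
proof -
  have r: "0 \<le> r" using assms(1) norm_ge_zero order_trans by blast
  have "norm (\<Sum>i<Suc n. y ^ (Suc n - Suc i) * x ^ i) \<le> (\<Sum>i<Suc n. r ^ n)"
  proof (rule sum_norm_le)
    fix i assume "i \<in> {..<Suc n}"
    then have "n = (Suc n - Suc i) + i" by simp
    then have "r ^ n = r ^ (Suc n - Suc i) * r ^ i" by (metis power_add)
    then show "norm (y ^ (Suc n - Suc i) * x ^ i) \<le> r ^ n"
      unfolding norm_mult norm_power using assms r by (auto intro!: mult_mono power_mono)
  qed
  then show ?thesis
    unfolding power_diff_sumr2 norm_mult by (subst mult.commute) (intro mult_right_mono; simp)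
qed

lemma norm_power_Suc_le:
  fixes q :: complex
  assumes "norm q \<le> 1 / 210"
  shows "norm (q ^ Suc n) \<le> 1 / 210" "norm (q ^ Suc n) \<le> norm q * (1 / 210) ^ n"
proof -
  show *: "norm (q ^ Suc n) \<le> norm q * (1 / 210) ^ n"
    unfolding power_Suc norm_mult norm_power using assms by (intro mult_left_mono power_mono) auto
  also have "\<dots> \<le> 1 / 210 * 1" using assms by (intro mult_mono power_le_one) auto
  finally show "norm (q ^ Suc n) \<le> 1 / 210" by simp
qed

text \<open>These are the only properties of \<open>geom_power3\<close> and
  \<open>geom_power5\<close> needed to show that the first term \<open>f q\<close>, and within it
  \<open>q\<close>, dominates the Lambert series.\<close>

locale lambert =
  fixes f :: "complex \<Rightarrow> complex" and C :: real
  assumes near_id: "\<And>x y. norm x \<le> 1 / 210 \<Longrightarrow> norm y \<le> 1 / 210 \<Longrightarrow>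
      norm ((f x - f y) - (x - y)) \<le> 1 / 2 * norm (x - y)"
    and quadratic: "\<And>q. norm q \<le> 1 / 210 \<Longrightarrow> norm (f q - q) \<le> C * norm q ^ 2"
begin

lemma norm_le: "norm q \<le> 1 / 210 \<Longrightarrow> norm (f q) \<le> 3 / 2 * norm q"
  \<comment> \<open>\<open>quadratic\<close> at 0 gives \<open>f 0 = 0\<close>, so
    \<open>near_id\<close> compares \<open>f q\<close> with \<open>q\<close>.\<close>
  using near_id[of q 0] quadratic[of 0] norm_triangle_sub[of "f q" q] by simp

lemma summable_norm: 
  assumes "norm q \<le> 1 / 210"
  shows "summable (\<lambda>n. norm (f (q ^ Suc n)))"
proof (rule summable_comparison_test')
  show "summable (\<lambda>n. 3 / 2 * (norm q * (1 / 210) ^ n))" by (intro summable_mult summable_geometric) auto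
  show "norm (norm (f (q ^ Suc n))) \<le> 3 / 2 * (norm q * (1 / 210) ^ n)" for n
    using norm_le[OF norm_power_Suc_le(1)[OF assms, of n]] norm_power_Suc_le(2)[OF assms, of n] by simp
qed

lemma summable:
  assumes "norm q \<le> 1 / 210"
  shows "summable (\<lambda>n. f (q ^ Suc n))"
  using summable_norm[OF assms] by (rule summable_norm_cancel)

text \<open>The terms after the first are bounded by a geometric series with sum
  \<open>3 / 2 * (210 / 209) * |q| ^ 2\<close>, below \<open>2 * |q| ^ 2\<close>.\<close>

lemma sum_quadratic:
  assumes q: "norm q \<le> 1 / 210"
  shows "norm ((\<Sum>n. f (q ^ Suc n)) - q) \<le> (C + 2) * norm q ^ 2"
proof -
  have "(\<Sum>n. f (q ^ Suc n)) = f q + (\<Sum>n. f (q ^ Suc (Suc n)))"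
    using suminf_split_head[OF summable[OF q]] by simp
  moreover have "norm (\<Sum>n. f (q ^ Suc (Suc n))) \<le> (\<Sum>n. 3 / 2 * norm q ^ 2 * (1 / 210) ^ n)"
  proof (rule norm_suminf_le)
    fix n
    have "norm (f (q ^ Suc (Suc n))) \<le> 3 / 2 * norm (q * q ^ Suc n)"
      using norm_le[OF norm_power_Suc_le(1)[OF q, of "Suc n"]] by simp
    also have "\<dots> \<le> 3 / 2 * (norm q * (norm q * (1 / 210) ^ n))"
      unfolding norm_mult using norm_power_Suc_le(2)[OF q, of n] by (intro mult_left_mono) auto
    finally show "norm (f (q ^ Suc (Suc n))) \<le> 3 / 2 * norm q ^ 2 * (1 / 210) ^ n"
      by (simp add: power2_eq_square)
  qed (intro summable_mult summable_geometric; simp)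
  moreover have "(\<Sum>n. 3 / 2 * norm q ^ 2 * (1 / 210) ^ n) = 3 / 2 * norm q ^ 2 * (210 / 209)"
    by (subst suminf_mult) (auto intro: summable_geometric simp: suminf_geometric)
  ultimately have "norm ((\<Sum>n. f (q ^ Suc n)) - q) \<le> C * norm q ^ 2 + 3 / 2 * norm q ^ 2 * (210 / 209)"
    using quadratic[OF q] norm_triangle_ineq[of "f q - q" "\<Sum>n. f (q ^ Suc (Suc n))"]
    by (simp add: algebra_simps)
  also have "\<dots> \<le> (C + 2) * norm q ^ 2" by (simp add: algebra_simps)
  finally show ?thesis .
qed

text \<open>The first term deviates from the identity by at most the factor \<open>1 / 2\<close> and
  the tail adds at most \<open>1 / 4\<close>. The total being below 1 is what gives
  injectivity.\<close>

lemma sum_near_id: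
  assumes x: "norm x \<le> 1 / 210" and y: "norm y \<le> 1 / 210"
  shows "norm (((\<Sum>n. f (x ^ Suc n)) - (\<Sum>n. f (y ^ Suc n))) - (x - y)) \<le> 3 / 4 * norm (x - y)"
proof -
  let ?d = "\<lambda>n. f (x ^ Suc n) - f (y ^ Suc n)"
  have d: "summable ?d" using summable[OF x] summable[OF y] by (rule summable_diff)
  have "(\<Sum>n. f (x ^ Suc n)) - (\<Sum>n. f (y ^ Suc n)) = (\<Sum>n. ?d n)"
    using suminf_diff[OF summable[OF x] summable[OF y]] by simp
  also have "\<dots> = (f x - f y) + (\<Sum>n. ?d (Suc n))"
    using suminf_split_head[OF d] by simp
  finally have eq: "(\<Sum>n. f (x ^ Suc n)) - (\<Sum>n. f (y ^ Suc n)) = (f x - f y) + (\<Sum>n. ?d (Suc n))" .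
  have "norm (\<Sum>n. ?d (Suc n)) \<le> (\<Sum>n. norm (x - y) * (3 / 210) * (2 / 210) ^ n)"
  proof (rule norm_suminf_le)
    fix n
    have "norm (?d (Suc n)) \<le> 3 / 2 * norm (x ^ Suc (Suc n) - y ^ Suc (Suc n))"
      using near_id[OF norm_power_Suc_le(1)[OF x, of "Suc n"] norm_power_Suc_le(1)[OF y, of "Suc n"]]
        norm_triangle_sub[of "?d (Suc n)" "x ^ Suc (Suc n) - y ^ Suc (Suc n)"] by linarith
    also have "\<dots> \<le> 3 / 2 * (of_nat (Suc (Suc n)) * (1 / 210) ^ Suc n * norm (x - y))"
      using norm_power_diff_le[OF x y, of "Suc n"] by (intro mult_left_mono) auto
    \<comment> \<open>Replacing \<open>n + 2\<close> by \<open>2 ^ (n + 1)\<close> makes the bound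
      geometric.\<close>
    also have "\<dots> \<le> 3 / 2 * (2 ^ Suc n * (1 / 210) ^ Suc n * norm (x - y))"
    proof (intro mult_left_mono mult_right_mono)
      have "Suc (Suc n) \<le> 2 ^ Suc n" by (induction n) auto
      then show "real (Suc (Suc n)) \<le> 2 ^ Suc n" by (metis of_nat_le_iff of_nat_numeral of_nat_power)
    qed auto
    also have "\<dots> = norm (x - y) * (3 / 210) * (2 / 210) ^ n"
      unfolding power_mult_distrib [symmetric] by simp
    finally show "norm (?d (Suc n)) \<le> norm (x - y) * (3 / 210) * (2 / 210) ^ n" .
  qed (intro summable_mult summable_geometric; simp)
  also have "\<dots> = norm (x - y) * (3 / 210) * (210 / 208)"
    by (subst suminf_mult) (auto intro: summable_geometric simp: suminf_geometric)
  also have "\<dots> \<le> 1 / 4 * norm (x - y)" by simp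
  finally have "norm (\<Sum>n. ?d (Suc n)) \<le> 1 / 4 * norm (x - y)" .
  with near_id[OF x y] show ?thesis
    unfolding eq using norm_triangle_ineq[of "f x - f y - (x - y)" "\<Sum>n. ?d (Suc n)"]
    by (simp add: algebra_simps)
qed

lemma continuous_on_sum: "continuous_on (cball 0 (1 / 210)) (\<lambda>q. \<Sum>n. f (q ^ Suc n))"
proof (rule lipschitz_on_continuous_on[where L = "7 / 4"], rule lipschitz_onI)
  fix x y :: complex assume "x \<in> cball 0 (1 / 210)" "y \<in> cball 0 (1 / 210)"
  then show "dist (\<Sum>n. f (x ^ Suc n)) (\<Sum>n. f (y ^ Suc n)) \<le> 7 / 4 * dist x y"
    using sum_near_id[of x y] norm_triangle_sub[of "(\<Sum>n. f (x ^ Suc n)) - (\<Sum>n. f (y ^ Suc n))" "x - y"]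
    by (simp add: dist_norm)
qed simp

end

interpretation lambert3: lambert geom_power3 9
  by standard (use geom_power3_near_identity geom_power3_bound in auto)

interpretation lambert5: lambert geom_power5 34
  by standard (use geom_power5_near_identity geom_power5_bound in auto)

lemma lambert3_inj:
  assumes "norm x \<le> 1 / 210" "norm y \<le> 1 / 210" "lambert3 x = lambert3 y"
  shows "x = y"
  using lambert3.sum_near_id[OF assms(1,2)] assms(3) by (simp add: lambert3_def norm_minus_commute)

text \<open>The linear term of the difference is \<open>(720 + 1008) * q = 1728 * q\<close>, and on
  this disc the remaining terms are smaller in norm.\<close>

lemma discriminant_nonzero:
  assumes q: "norm q \<le> 1 / 210" "q \<noteq> 0"
  shows "(1 + 240 * lambert3 q) ^ 3 - (1 - 504 * lambert5 q) ^ 2 \<noteq> 0"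
proof
  define t where "t = norm q"
  define a b where ab_def: "a = lambert3 q - q" "b = lambert5 q - q"
  have t: "0 < t" "t \<le> 1 / 210" using q by (auto simp: t_def)
  have a: "norm a \<le> 11 * t ^ 2" and b: "norm b \<le> 36 * t ^ 2"
    using lambert3.sum_quadratic[OF q(1)] lambert5.sum_quadratic[OF q(1)]
    by (simp_all add: ab_def lambert3_def lambert5_def t_def)
  have A: "lambert3 q = q + a" "lambert5 q = q + b" by (simp_all add: ab_def)
  assume "(1 + 240 * lambert3 q) ^ 3 - (1 - 504 * lambert5 q) ^ 2 = 0"
  \<comment> \<open>Here \<open>q + a\<close> and \<open>q + b\<close> replace the Lambert series;
    only the linear term in \<open>q\<close> stays on the left.\<close>
  then have "- 1728 * q = 720 * a + 1008 * b + (- 81216) * q ^ 2 + 345600 * (q * a) + 172800 * a ^ 2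
      + (- 508032) * (q * b) + (- 254016) * b ^ 2 + 13824000 * (q + a) ^ 3" (is "_ = ?S")
    unfolding A by (simp add: algebra_simps power_numeral_reduce)
  then have "norm (- 1728 * q) = norm ?S" by (rule arg_cong)
  then have "1728 * t = norm ?S" by (simp add: norm_mult t_def)
  also have "norm ?S \<le> 720 * (11 * t ^ 2) + 1008 * (36 * t ^ 2) + 81216 * t ^ 2 + 345600 * (t * (11 * t ^ 2))
      + 172800 * (11 * t ^ 2) ^ 2 + 508032 * (t * (36 * t ^ 2)) + 254016 * (36 * t ^ 2) ^ 2 + 13824000 * (t + 11 * t ^ 2) ^ 3"
  proof -
    have scale: "norm (c * u) \<le> norm c * v" if "norm u \<le> v" for c u :: complex and v
      using that by (simp add: norm_mult mult_left_mono)
    have "norm (q * a) \<le> t * (11 * t ^ 2)" "norm (q * b) \<le> t * (36 * t ^ 2)"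
      unfolding norm_mult t_def[symmetric] using a b t by (auto intro: mult_left_mono)
    moreover have "norm (q ^ 2) \<le> t ^ 2" "norm (a ^ 2) \<le> (11 * t ^ 2) ^ 2" "norm (b ^ 2) \<le> (36 * t ^ 2) ^ 2"
      unfolding norm_power t_def[symmetric] using power_mono[OF a, of 2] power_mono[OF b, of 2] by simp_all
    moreover have "norm ((q + a) ^ 3) \<le> (t + 11 * t ^ 2) ^ 3"
      unfolding norm_power using a by (intro power_mono norm_triangle_mono) (auto simp: t_def)
    ultimately show ?thesis
      using a b scale[of a _ 720] scale[of b _ 1008] scale[of "q ^ 2" _ "- 81216"] scale[of "q * a" _ 345600]
        scale[of "a ^ 2" _ 172800] scale[of "q * b" _ "- 508032"] scale[of "b ^ 2" _ "- 254016"] scale[of "(q + a) ^ 3" _ 13824000]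
      by (intro norm_triangle_mono) (simp_all only: norm_neg_numeral norm_numeral)
  qed
  also have "\<dots> = t * (125424 * t + 22090752 * t ^ 2 + 350113536 * t ^ 3 + 13824000 * t ^ 2 * (1 + 11 * t) ^ 3)"
    by (simp add: algebra_simps power_numeral_reduce)
  \<comment> \<open>The bracket increases with \<open>t\<close>; at \<open>1 / 210\<close> it is
    about 1501.\<close>
  also have "\<dots> \<le> t * (125424 * (1 / 210) + 22090752 * (1 / 210) ^ 2 + 350113536 * (1 / 210) ^ 3 + 13824000 * (1 / 210) ^ 2 * (1 + 11 * (1 / 210)) ^ 3)"
    using t by (intro mult_left_mono add_mono mult_mono power_mono) auto
  also have "\<dots> < t * 1728"
    using t by (intro mult_strict_left_mono) (simp_all add: power_numeral_reduce)
  finally show False by simp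
qed

subsection \<open>Zeros of the modular function\<close>

text \<open>Otherwise monotonicity gives \<open>1 / 2 = sin (pi / 6) < sin (31 / 60)\<close>, while
  the Taylor bound for the latter is below \<open>1 / 2\<close>.\<close>

lemma pi_ge_31_10: "pi \<ge> 31 / 10"
proof (rule ccontr)
  assume "\<not> pi \<ge> 31 / 10"
  then have "pi / 6 < 31 / 60" by simp
  then have "sin (pi / 6) < sin (31 / 60)"
    using pi_ge_two by (intro sin_monotone_2pi) auto
  moreover have "sin (31 / 60 :: real) \<le> 31 / 60 - (31 / 60) ^ 3 / 6 + (31 / 60) ^ 5 / 120"
  proof -
    have "\<bar>sin (31 / 60) - (31 / 60 - (31 / 60) ^ 3 / 6)\<bar> \<le> (31 / 60 :: real) ^ 5 / 120"
      using Maclaurin_sin_bound[of "31 / 60" 5]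
      by (simp add: sin_coeff_def lessThan_nat_numeral fact_numeral)
    then show ?thesis by linarith
  qed
  ultimately show False by (simp add: sin_30 power_divide)
qed

text \<open>The exponent is at least \<open>5.369\<close>; the Taylor polynomial of degree 4 is used
  at a tenth of this, and the result is raised to the tenth power.\<close>

lemma exp_pi_sqrt3: "exp (pi * sqrt 3) \<ge> 210"
proof -
  have "1732 / 1000 \<le> sqrt 3" by (rule real_le_rsqrt) (simp add: power2_eq_square)
  then have "31 / 10 * (1732 / 1000) \<le> pi * sqrt 3"
    using pi_ge_31_10 by (intro mult_mono) auto
  then have "exp (10 * (5369 / 10000)) \<le> exp (pi * sqrt 3)" by simp
  moreover have "exp (10 * (5369 / 10000) :: real) = exp (5369 / 10000) ^ 10"
    using exp_of_nat_mult[of 10 "5369 / 10000 :: real"] by simp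
  moreover have "17102 / 10000 \<le> exp (5369 / 10000 :: real)"
  proof -
    have "(\<Sum>n<5. (5369 / 10000) ^ n /\<^sub>R fact n) \<le> exp (5369 / 10000 :: real)"
      unfolding exp_def using summable_exp_generic[of "5369 / 10000 :: real"]
      by (intro sum_le_suminf) auto
    then show ?thesis by (simp add: lessThan_nat_numeral fact_numeral power_divide)
  qed
  then have "(17102 / 10000) ^ 10 \<le> exp (5369 / 10000 :: real) ^ 10" by (intro power_mono) auto
  moreover have "(210 :: real) \<le> (17102 / 10000) ^ 10" by (simp add: power_divide)
  ultimately show ?thesis by linarith
qed

lemma norm_nome_le:
  assumes "Im z \<ge> sqrt 3 / 2"
  shows "norm (nome z) \<le> 1 / 210"
proof -
  have "norm (nome z) = exp (- (2 * pi * Im z))" by (simp add: nome_def)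
  also have "\<dots> \<le> exp (- (pi * sqrt 3))" using assms by simp
  also have "\<dots> \<le> 1 / 210" using exp_pi_sqrt3 by (simp add: exp_minus field_simps)
  finally show ?thesis .
qed

section \<open>Zeros and continuity of \<open>modular_j\<close> in a closed half plane\<close>

definition rho :: complex where "rho = Complex (- 1 / 2) (sqrt 3 / 2)"

text \<open>The map \<open>z \<mapsto> - 1 / (z + 1)\<close> fixes \<open>\<rho>\<close>, with automorphy factor different from 1.\<close>

lemma eisenstein_G_4_rho: "eisenstein_G 4 rho = 0"
proof -
  have sq: "rho ^ 2 = - rho - 1"
    by (simp add: rho_def complex_eq_iff power2_eq_square field_simps)
  have nz: "of_int 1 * rho + of_int 1 \<noteq> 0" by (simp add: rho_def complex_eq_iff)
  have fixed: "(of_int 0 * rho + of_int (- 1)) / (of_int 1 * rho + of_int 1) = rho"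
  proof -
    have "rho * (rho + 1) = rho ^ 2 + rho" by (simp add: power2_eq_square distrib_left)
    then have "rho * (rho + 1) = - 1" using sq by simp
    then have "- 1 / (rho + 1) = rho" using nz by (metis nonzero_mult_div_cancel_right of_int_1 mult_1)
    then show ?thesis by simp
  qed
  have "eisenstein_G 4 rho = (rho + 1) ^ 4 * eisenstein_G 4 rho"
  proof -
    have "0 * 1 - (- 1) * 1 = (1 :: int)" by simp
    from eisenstein_G_modular[OF this nz, of 4, unfolded fixed] show ?thesis
      unfolding of_int_1 mult_1 .
  qed
  moreover have "(rho + 1) ^ 4 = - rho - 1"
  proof -
    have "(rho + 1) ^ 2 = rho" by (simp add: power2_sum sq)
    then have "(rho + 1) ^ 4 = rho ^ 2" by (metis mult_2 numeral_Bit0 power_mult)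
    then show ?thesis by (simp add: sq)
  qed
  moreover have "- rho - 1 \<noteq> 1" by (simp add: rho_def complex_eq_iff)
  ultimately show ?thesis by (metis mult_cancel_right1)
qed

lemma modular_j_rho: "modular_j rho = 0"
  by (simp add: modular_j_def modular_g2_def eisenstein_G_4_rho)

lemma Im_pos_of_ge: "Im z \<ge> sqrt 3 / 2 \<Longrightarrow> Im z > 0"
  using real_sqrt_gt_zero[of 3] by linarith

text \<open>A nonzero discriminant rules out that the value 0 comes from division by zero, so
  \<open>E4\<close> vanishes at \<open>z\<close>. It also vanishes at \<open>rho\<close>, and
  injectivity of \<open>lambert3\<close> identifies the two values of \<open>nome\<close>.\<close>

lemma modular_j_zero_imp:
  assumes z: "Im z \<ge> sqrt 3 / 2" and "modular_j z = 0"
  shows "z - rho \<in> \<int>"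
proof -
  have rho: "Im rho \<ge> sqrt 3 / 2" by (simp add: rho_def)
  have "nome z \<noteq> 0" by (simp add: nome_def)
  then have "(1 + 240 * lambert3 (nome z)) ^ 3 - (1 - 504 * lambert5 (nome z)) ^ 2 \<noteq> 0"
    using discriminant_nonzero norm_nome_le[OF z] by blast
  then have "1 + 240 * lambert3 (nome z) = 0"
    using assms(2) unfolding modular_j_eq[OF Im_pos_of_ge[OF z]] by simp
  moreover have "1 + 240 * lambert3 (nome rho) = 0"
    using eisenstein_G_4_rho unfolding eisenstein_G_4_eq[OF Im_pos_of_ge[OF rho]] by simp
  ultimately have "240 * lambert3 (nome z) = 240 * lambert3 (nome rho)" by (metis add_left_cancel)
  then have "lambert3 (nome z) = lambert3 (nome rho)" by simp
  then have "nome z = nome rho" using lambert3_inj norm_nome_le[OF z] norm_nome_le[OF rho] by blast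
  then show ?thesis by (simp add: nome_eq_iff)
qed

text \<open>The boundary line is included because the limit in the final argument is taken at points
  on it.\<close>

lemma modular_j_continuous_on: "continuous_on {z. Im z \<ge> sqrt 3 / 2} modular_j"
proof -
  have n: "continuous_on {z. Im z \<ge> sqrt 3 / 2} nome"
    unfolding nome_def[abs_def] by (intro continuous_intros)
  have im: "nome ` {z. Im z \<ge> sqrt 3 / 2} \<subseteq> cball 0 (1 / 210)" using norm_nome_le by auto
  have l3: "continuous_on {z. Im z \<ge> sqrt 3 / 2} (\<lambda>z. lambert3 (nome z))"
    unfolding lambert3_def by (rule continuous_on_compose2[OF lambert3.continuous_on_sum n im])
  have l5: "continuous_on {z. Im z \<ge> sqrt 3 / 2} (\<lambda>z. lambert5 (nome z))"
    unfolding lambert5_def by (rule continuous_on_compose2[OF lambert5.continuous_on_sum n im])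
  have "continuous_on {z. Im z \<ge> sqrt 3 / 2} (\<lambda>z. 1728 * (1 + 240 * lambert3 (nome z)) ^ 3 /
      ((1 + 240 * lambert3 (nome z)) ^ 3 - (1 - 504 * lambert5 (nome z)) ^ 2))"
  proof (intro continuous_intros l3 l5 ballI)
    fix z assume "z \<in> {z. Im z \<ge> sqrt 3 / 2}"
    moreover have "nome z \<noteq> 0" by (simp add: nome_def)
    ultimately show "(1 + 240 * lambert3 (nome z)) ^ 3 - (1 - 504 * lambert5 (nome z)) ^ 2 \<noteq> 0"
      using discriminant_nonzero norm_nome_le by blast
  qed
  then show ?thesis
    by (rule continuous_on_eq) (use modular_j_eq Im_pos_of_ge in auto)
qed

section \<open>Reduction to affine arguments\<close>

lemma modular_j_plus_int: "modular_j (w + of_int m) = modular_j w"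
  using modular_j_modular[of 1 1 m 0 w] by simp

lemma complex_of_real_of_rat: "complex_of_real (of_rat x) = of_rat x"
  by (cases x) (simp add: of_rat_rat)

text \<open>Left multiplication by an integer matrix of determinant 1 makes \<open>g\<close> upper
  triangular without changing the value of \<open>modular_j\<close>.\<close>

lemma modular_j_moebius_eq_affine:
  assumes "g \<in> GL2_pos_rat"
  obtains \<alpha> \<beta> :: real where "\<alpha> > 0"
    "\<And>z. z \<in> upper_half_plane \<Longrightarrow> modular_j (moebius_act g z) = modular_j (of_real \<alpha> * z + of_real \<beta>)"
proof -
  define a b c d where "a = g $ 1 $ 1" and "b = g $ 1 $ 2" and "c = g $ 2 $ 1" and "d = g $ 2 $ 2"
  note abcd = this
  have det: "a * d - b * c > 0"
    using assms by (simp add: GL2_pos_rat_def det_2 abcd)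
  \<comment> \<open>The pair \<open>(s, t)\<close> is the bottom row of that matrix, chosen to kill
    the lower left entry; Bezout coefficients then give its top row \<open>(u, v)\<close>.\<close>
  obtain s t :: int where st: "coprime s t" "of_int s * a + of_int t * c = 0"
  proof (cases "c = 0")
    case True then show ?thesis using that[of 0 1] by simp
  next
    case False
    obtain p q where pq: "quotient_of (a / c) = (p, q)" by force
    have "q > 0" using quotient_of_denom_pos[OF pq] .
    have "a / c = of_int p / of_int q" using quotient_of_div[OF pq] .
    then have "of_int q * a + of_int (- p) * c = 0"
      using False \<open>q > 0\<close> by (simp add: field_simps)
    moreover have "coprime q (- p)" using quotient_of_coprime[OF pq] by (simp add: coprime_commute)
    ultimately show ?thesis using that by blast
  qed
  obtain u v where uv: "u * t - v * s = 1"
  proof -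
    obtain x y where "x * s + y * t = 1" using bezout_int[of s t] st(1) by auto
    then show ?thesis using that[of y "- x"] by (simp add: algebra_simps)
  qed
  \<comment> \<open>The product matrix has rows \<open>(A, B)\<close> and \<open>(0, D)\<close>, so
    \<open>A * D\<close> is the determinant of \<open>g\<close>.\<close>
  define A D B where "A = of_int u * a + of_int v * c" "D = of_int s * b + of_int t * d" "B = of_int u * b + of_int v * d"
  have AD: "A * D > 0"
  proof -
    have "A * D = A * D - B * (of_int s * a + of_int t * c)" using st(2) by simp
    also have "\<dots> = (a * d - b * c) * of_int (u * t - v * s)" by (simp add: A_D_B_def algebra_simps)
    also have "\<dots> = a * d - b * c" by (simp add: uv)
    finally show ?thesis using det by simp
  qed
  show ?thesis
  proof (rule that[of "of_rat (A / D)" "of_rat (B / D)"])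
    show "(of_rat (A / D) :: real) > 0" using AD by (simp add: zero_less_divide_iff zero_less_mult_iff)
    fix z assume z: "z \<in> upper_half_plane"
    let ?w = "moebius_act g z"
    have D: "of_rat D \<noteq> (0 :: complex)" using AD by auto
    let ?a = "of_rat a :: complex" and ?b = "of_rat b :: complex" and ?c = "of_rat c :: complex" and ?d = "of_rat d :: complex"
    have nz: "?c * z + ?d \<noteq> 0"
    proof
      assume *: "?c * z + ?d = 0"
      have "Im (of_real (of_rat c) * z + of_real (of_rat d)) = 0"
        using arg_cong[OF *, of Im] by (simp only: complex_of_real_of_rat zero_complex.sel)
      then have "c = 0" using z by (simp add: upper_half_plane_def)
      with * have "d = 0" by simp
      with \<open>c = 0\<close> det show False by simp
    qed
    have w: "?w = (?a * z + ?b) / (?c * z + ?d)" by (simp add: moebius_act_def abcd)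
    have "of_int s * ?a + of_int t * ?c = 0"
      using arg_cong[OF st(2), of "of_rat :: rat \<Rightarrow> complex"] by (simp add: of_rat_add of_rat_mult)
    then have "(of_int s * ?a + of_int t * ?c) * z + (of_int s * ?b + of_int t * ?d) = of_rat D"
      by (simp add: A_D_B_def of_rat_add of_rat_mult)
    then have e1: "of_int s * ?w + of_int t = of_rat D / (?c * z + ?d)"
      unfolding w using nz by (simp add: field_simps)
    have e2: "of_int u * ?w + of_int v = (of_rat A * z + of_rat B) / (?c * z + ?d)"
      unfolding w using nz by (simp add: A_D_B_def of_rat_add of_rat_mult field_simps)
    have "modular_j ((of_int u * ?w + of_int v) / (of_int s * ?w + of_int t)) = modular_j ?w"
      by (rule modular_j_modular) (use uv e1 D nz in auto)
    moreover have "(of_int u * ?w + of_int v) / (of_int s * ?w + of_int t) = of_real (of_rat (A / D)) * z + of_real (of_rat (B / D))"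
    proof -
      have cancel: "(x / p) / (y / p) = x / y" if "p \<noteq> 0" for x y p :: complex using that by simp
      show ?thesis
        unfolding e1 e2 cancel[OF nz] by (simp add: complex_of_real_of_rat of_rat_divide add_divide_distrib)
    qed
    ultimately show "modular_j ?w = modular_j (of_real (of_rat (A / D)) * z + of_real (of_rat (B / D)))" by simp
  qed
qed

section \<open>Independence from comparing the highest zeros\<close>

theorem theorem1p3:
  fixes k :: nat and g :: "nat \<Rightarrow> rat ^ 2 ^ 2"
  assumes "\<And>i. i \<in> {1..k} \<Longrightarrow> g i \<in> GL2_pos_rat"
    and "\<And>i l. i \<in> {1..k} \<Longrightarrow> l \<in> {1..k} \<Longrightarrow> i \<noteq> l \<Longrightarrow>
           \<exists>z\<in>upper_half_plane. modular_j (moebius_act (g i) z) \<noteq> modular_j (moebius_act (g l) z)"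
  shows "mult_indep_mod_constants k (\<lambda>i z. modular_j (moebius_act (g i) z))"
  unfolding mult_indep_mod_constants_def
proof (intro notI, elim exE conjE)
  fix n :: "nat \<Rightarrow> int" and c :: complex
  assume n: "\<exists>i\<in>{1..k}. n i \<noteq> 0"
    and rel: "\<forall>z\<in>upper_half_plane. (\<forall>i\<in>{1..k}. n i < 0 \<longrightarrow> modular_j (moebius_act (g i) z) \<noteq> 0) \<longrightarrow>
        (\<Prod>i\<in>{1..k}. modular_j (moebius_act (g i) z) powi n i) = c"
  have "\<forall>i\<in>{1..k}. \<exists>p :: real \<times> real. fst p > 0 \<and> (\<forall>z\<in>upper_half_plane.
      modular_j (moebius_act (g i) z) = modular_j (of_real (fst p) * z + of_real (snd p)))"
  proof
    fix i assume "i \<in> {1..k}"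
    then obtain a b :: real where "a > 0"
      "\<And>z. z \<in> upper_half_plane \<Longrightarrow> modular_j (moebius_act (g i) z) = modular_j (of_real a * z + of_real b)"
      using modular_j_moebius_eq_affine[OF assms(1)] by metis
    then show "\<exists>p :: real \<times> real. fst p > 0 \<and> (\<forall>z\<in>upper_half_plane.
      modular_j (moebius_act (g i) z) = modular_j (of_real (fst p) * z + of_real (snd p)))"
      by (intro exI[of _ "(a, b)"]) simp
  qed
  from bchoice[OF this] obtain p :: "nat \<Rightarrow> real \<times> real" where p: "\<forall>i\<in>{1..k}. fst (p i) > 0 \<and> (\<forall>z\<in>upper_half_plane.
      modular_j (moebius_act (g i) z) = modular_j (of_real (fst (p i)) * z + of_real (snd (p i))))" ..
  define \<alpha> \<beta> where "\<alpha> i = fst (p i)" and "\<beta> i = snd (p i)" for i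
  have \<alpha>: "\<alpha> i > 0" if "i \<in> {1..k}" for i using p that by (simp add: \<alpha>_def)
  have j: "modular_j (moebius_act (g i) z) = modular_j (of_real (\<alpha> i) * z + of_real (\<beta> i))"
    if "i \<in> {1..k}" "z \<in> upper_half_plane" for i z
    using p that unfolding \<alpha>_def \<beta>_def by blast
  define S where "S = {i \<in> {1..k}. n i \<noteq> 0}"
  have S: "finite S" "S \<noteq> {}" "S \<subseteq> {1..k}" using n by (auto simp: S_def)
  obtain m where m: "m \<in> S" "\<And>i. i \<in> S \<Longrightarrow> \<alpha> m \<le> \<alpha> i"
    using ex_min_if_finite[of "\<alpha> ` S"] S by (metis (no_types, lifting) finite_imageI image_iff image_is_empty not_le)
  have \<alpha>m: "\<alpha> m > 0" using \<alpha> m S by blast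
  \<comment> \<open>The point \<open>z = (rho + i * t - \<beta> m) / \<alpha> m\<close> descends to
    a highest zero of the \<open>m\<close>-th function as \<open>t\<close> decreases to 0, and
    \<open>w i t\<close> is \<open>\<alpha> i * z + \<beta> i\<close>; in particular
    \<open>w m t = rho + i * t\<close>.\<close>
  define w where "w i t = of_real (\<alpha> i) * ((rho + \<i> * of_real t - of_real (\<beta> m)) / of_real (\<alpha> m)) + of_real (\<beta> i)" for i and t :: real
  define f where "f i t = modular_j (w i t)" for i t
  have Im_w: "Im (w i t) = \<alpha> i / \<alpha> m * (sqrt 3 / 2 + t)" for i t
    using \<alpha>m by (simp add: w_def rho_def)
  have ratio: "1 \<le> \<alpha> i / \<alpha> m" if "i \<in> S" for i using m(2)[OF that] \<alpha>m by simp
  have Im_ge: "sqrt 3 / 2 + t \<le> Im (w i t)" if "i \<in> S" "t \<ge> 0" for i t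
    unfolding Im_w using mult_right_mono[OF ratio[OF that(1)], of "sqrt 3 / 2 + t"] that by simp
  \<comment> \<open>For \<open>t > 0\<close> all arguments lie strictly above the height of
    \<open>rho\<close>.\<close>
  have nonzero: "f i t \<noteq> 0" if "i \<in> S" "t > 0" for i t
  proof
    assume "f i t = 0"
    then have "w i t - rho \<in> \<int>" using modular_j_zero_imp[of "w i t"] Im_ge[OF that(1), of t] that by (simp add: f_def)
    then have "Im (w i t) = sqrt 3 / 2" by (auto simp: complex_is_Int_iff rho_def)
    with Im_ge[OF that(1), of t] that show False by simp
  qed
  have f_m: "f m 0 = 0"
    using \<alpha>m modular_j_rho by (simp add: f_def w_def)
  \<comment> \<open>A second zero at \<open>t = 0\<close> would have to lie at the same height,
    forcing two of the given functions to coincide.\<close>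
  have nonzero0: "f i 0 \<noteq> 0" if "i \<in> S - {m}" for i
  proof
    assume "f i 0 = 0"
    then have int: "w i 0 - rho \<in> \<int>" using modular_j_zero_imp[of "w i 0"] Im_ge[of i 0] that by (simp add: f_def)
    then have "\<alpha> i = \<alpha> m"
      using \<alpha>m by (auto simp: complex_is_Int_iff Im_w rho_def field_simps)
    then have "w i 0 - rho = of_real (\<beta> i - \<beta> m)" using \<alpha>m by (simp add: w_def)
    with int obtain N :: int where "of_real (\<beta> i - \<beta> m) = (of_int N :: complex)" by (metis Ints_cases)
    then have N: "of_real (\<beta> i) = of_real (\<beta> m) + (of_int N :: complex)" by (simp add: algebra_simps)
    have "modular_j (moebius_act (g i) z) = modular_j (moebius_act (g m) z)" if z: "z \<in> upper_half_plane" for z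
      using that j[of i z] j[of m z] \<open>i \<in> S - {m}\<close> m(1) S(3) modular_j_plus_int[of "of_real (\<alpha> m) * z + of_real (\<beta> m)" N]
      by (simp add: subset_iff N \<open>\<alpha> i = \<alpha> m\<close> add.assoc)
    with assms(2)[of i m] that m(1) S(3) show False by blast
  qed
  have lim: "((\<lambda>t. f i t) \<longlongrightarrow> f i 0) (at_right 0)" if "i \<in> S" for i
  proof -
    have "continuous_on {0..} (\<lambda>t. f i t)"
      unfolding f_def
    proof (rule continuous_on_compose2[OF modular_j_continuous_on])
      show "continuous_on {0..} (\<lambda>t. w i t)" unfolding w_def using \<alpha>m by (intro continuous_intros) auto
      show "(\<lambda>t. w i t) ` {0..} \<subseteq> {z. Im z \<ge> sqrt 3 / 2}" using Im_ge[OF that] by force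
    qed
    then have "((\<lambda>t. f i t) \<longlongrightarrow> f i 0) (at 0 within {0..})" by (simp add: continuous_on_def)
    then show ?thesis by (rule tendsto_within_subset) auto
  qed
  \<comment> \<open>By \<open>nonzero\<close> the side condition of the relation holds for
    \<open>t > 0\<close>; indices with exponent 0 contribute factors 1.\<close>
  have rel': "f m t powi n m * (\<Prod>i\<in>S - {m}. f i t powi n i) = c" if t: "t > 0" for t
  proof -
    define z where "z = (rho + \<i> * of_real t - of_real (\<beta> m)) / of_real (\<alpha> m)"
    have z: "z \<in> upper_half_plane"
      using \<alpha>m t by (simp add: z_def upper_half_plane_def rho_def add_pos_pos)
    have fz: "modular_j (moebius_act (g i) z) = f i t" if "i \<in> {1..k}" for i
      using j[OF that z] by (simp add: f_def w_def z_def)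
    have "(\<Prod>i\<in>{1..k}. modular_j (moebius_act (g i) z) powi n i) = c"
      using rel z nonzero[OF _ t] fz by (force simp: S_def)
    also have "(\<Prod>i\<in>{1..k}. modular_j (moebius_act (g i) z) powi n i) = (\<Prod>i\<in>S. f i t powi n i)"
      by (rule prod.mono_neutral_cong_right) (auto simp: S_def fz)
    also have "\<dots> = f m t powi n m * (\<Prod>i\<in>S - {m}. f i t powi n i)"
      using S(1) m(1) by (rule prod.remove)
    finally show ?thesis .
  qed
  have limP: "((\<lambda>t. \<Prod>i\<in>S - {m}. f i t powi n i) \<longlongrightarrow> (\<Prod>i\<in>S - {m}. f i 0 powi n i)) (at_right 0)"
    using lim nonzero0 by (intro tendsto_prod tendsto_power_int) auto
  have P0: "(\<Prod>i\<in>S - {m}. f i 0 powi n i) \<noteq> 0"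
    using nonzero0 S(1) by (simp add: power_int_eq_0_iff)
  have ev: "eventually (\<lambda>t :: real. t > 0) (at_right 0)" by (simp add: eventually_at_right_less)
  have nm: "n m \<noteq> 0" using m(1) by (simp add: S_def)
  define N where "N = nat \<bar>n m\<bar>"
  have N: "N > 0" using nm by (simp add: N_def)
  have limN: "((\<lambda>t. f m t ^ N) \<longlongrightarrow> 0) (at_right 0)"
    using tendsto_power[OF lim[OF m(1)], of N] N by (simp add: f_m zero_power)
  show False
  proof (cases "n m > 0")
    case True
    then have "n m = int N" by (simp add: N_def)
    \<comment> \<open>The product tends to 0 but is constantly \<open>c\<close>, so
      \<open>c = 0\<close>, although no factor vanishes at \<open>t = 1\<close>.\<close>
    then have "((\<lambda>t. f m t powi n m * (\<Prod>i\<in>S - {m}. f i t powi n i)) \<longlongrightarrow> 0) (at_right 0)"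
      using tendsto_mult[OF limN limP] by simp
    moreover have "((\<lambda>t. f m t powi n m * (\<Prod>i\<in>S - {m}. f i t powi n i)) \<longlongrightarrow> c) (at_right 0)"
      by (rule tendsto_eventually) (use ev rel' in \<open>auto elim: eventually_mono\<close>)
    ultimately have "c = 0" using tendsto_unique[OF trivial_limit_at_right_real] by blast
    with rel'[of 1] nonzero[OF _ zero_less_one] m(1) S(1) show False
      by (auto simp: power_int_eq_0_iff)
  next
    case False
    then have nN: "n m = - int N" using nm by (simp add: N_def)
    \<comment> \<open>Clearing the negative power shows that the other factors multiply to
      \<open>c * f m t ^ N\<close>, which tends to 0, while their limit is nonzero.\<close>
    have "((\<lambda>t. c * f m t ^ N) \<longlongrightarrow> 0) (at_right 0)"
      using tendsto_mult[OF tendsto_const limN, of c] by simp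
    moreover have "((\<lambda>t. c * f m t ^ N) \<longlongrightarrow> (\<Prod>i\<in>S - {m}. f i 0 powi n i)) (at_right 0)"
    proof (rule Lim_transform_eventually[OF limP])
      show "\<forall>\<^sub>F t in at_right 0. (\<Prod>i\<in>S - {m}. f i t powi n i) = c * f m t ^ N"
        using ev
      proof eventually_elim
        case (elim t)
        with rel'[OF elim] nonzero[OF m(1) elim] show ?case
          by (auto simp: nN power_int_minus field_simps)
      qed
    qed
    ultimately show False using P0 tendsto_unique[OF trivial_limit_at_right_real] by blast
  qed
qed

end
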